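(* There is an absolute constant $C>0$ such that the following holds. Let $n$ be a positive integer, let $G=\mathbb{F}_2^n$, and let $M$ be a positive real number. Suppose that $f:G\to\{0,1\}$ satisfies $\|f\|_A\leq M$. Then there are a non-negative integer $L\leq 2^{2^{CM^4}}$, subgroups $H_1,\dots,H_L\leq G$ and a choice of signs such that \[ f=\sum_{j=1}^L \pm 1_{H_j}.\]
   Context: For $f:G\to\mathbb{R}$ with $G=\mathbb{F}_2^n$, the Fourier transform is $\widehat{f}(r):=\mathbb{E}_{x\in G}f(x)(-1)^{r^Tx}=\frac{1}{|G|}\sum_{x\in G}f(x)(-1)^{r^Tx}$ for $r\in\widehat{G}$, where the dual group $\widehat{G}$ is identified with $\mathbb{F}_2^n$ via the scalar product $r^Tx$. The spectral norm is $\|f\|_A:=\sum_{r\in\widehat{G}}|\widehat{f}(r)|$. $1_H$ denotes the indicator function of $H$. The constant $C$ is independent of $n$, $M$ and $f$. The subgroups $H_j$ need not be distinct; an empty sum is $0$. *)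

theory Defs
  imports Complex_Main "HOL-Library.Z2" "HOL-Library.Indicator_Function"
    "HOL-Algebra.Coset" "Jordan_Normal_Form.Matrix"
begin

abbreviation F2_group :: "nat \<Rightarrow> bit vec monoid" where
  "F2_group n \<equiv> monoid_vec TYPE(bit) n"

text \<open>The dual group of \<open>F2_group n\<close> is identified with \<open>F2_group n\<close> itself via the scalar product.
  Values of \<open>f\<close> outside the carrier play no role.\<close>

definition fourier_transform :: "nat \<Rightarrow> (bit vec \<Rightarrow> real) \<Rightarrow> bit vec \<Rightarrow> real" where
  "fourier_transform n f r =
     (\<Sum>x\<in>carrier (F2_group n). f x * (-1) ^ of_bit (r \<bullet> x)) / real (card (carrier (F2_group n)))"

definition spectral_norm :: "nat \<Rightarrow> (bit vec \<Rightarrow> real) \<Rightarrow> real" where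
  "spectral_norm n f = (\<Sum>r\<in>carrier (F2_group n). \<bar>fourier_transform n f r\<bar>)"

end

theory Submission
  imports Defs "HOL-Analysis.Convex"
begin

text \<open>
  Let \<open>V\<close> be the group of \<open>n\<close>-dimensional vectors over the field with two elements, with characters
  \<open>chi r\<close>.  A function of spectral norm at most \<open>M\<close> is \<open>g = (\<Sum>r. c r * chi r)\<close> with
  \<open>(\<Sum>r. \<bar>c r\<bar>) \<le> M\<close>.  The theorem follows by splitting off, again and again, a piece that is constant
  on the cosets of a large subspace, at a cost of at least \<open>1/2\<close> in the spectral norm each time.

  One round takes an integer-valued \<open>f\<close>, with support \<open>A\<close>, that is uniformly close to a function
  \<open>g\<close> of spectral norm at most \<open>M\<close>.  It produces a subspace \<open>H\<close>, not much smaller than \<open>A\<close>, such that \<open>g\<close> has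
  tiny variance on every coset of \<open>H\<close> and does not average to nearly \<open>0\<close> on all of them
  (\<open>exists_concentrating_subspace\<close>).  The coset averages of \<open>g\<close> are then close to integers.  Rounding them
  gives an \<open>H\<close>-invariant integer-valued \<open>Z\<close> that vanishes off boundedly many cosets of \<open>H\<close>; since a coset
  of \<open>H\<close> other than \<open>H\<close> is the difference of two subspaces, \<open>Z\<close> is a short signed sum of indicators of
  subspaces (\<open>signed_sum_invariant\<close>).  What is left, \<open>f - Z\<close>, is close to \<open>g\<close> minus its coset averages.
  Averaging over cosets keeps the coefficients \<open>c r\<close> for which \<open>chi r\<close> is trivial on \<open>H\<close> and deletes the others,
  so the norms of the two parts add up to the norm of \<open>g\<close>; some average has absolute value at least \<open>1/2\<close>, so
  the remainder has lost at least \<open>1/2\<close>.  After about \<open>2 * M\<close> rounds nothing remains (\<open>signed_sum_of_near_integer\<close>).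

  The subspace is found as follows.  Prescribe the values of boundedly many characters, so as to cut \<open>A\<close>
  into cells.  An energy increment argument chooses them in such a way that inside a typical cell \<open>S\<close> the
  characters are almost uncorrelated, on average with respect to the weights \<open>\<bar>c r\<bar>\<close>
  (\<open>exists_pinned_cell\<close>).  Consequently \<open>a \<mapsto> g (t + a)\<close> has tiny variance on \<open>S\<close> simultaneously for all
  translations \<open>t\<close> (\<open>variance_of_translates\<close>).  Because \<open>f\<close> is integer-valued, this is a dichotomy: almost
  all of \<open>t + S\<close> lies in \<open>A\<close>, or almost none of it.  Among the \<open>t\<close> that map the cell to itself, those of the first kind
  almost stabilise \<open>S\<close>; two almost-stabilisers compose to a translation that is not of the second kind, hence is
  of the first, so they form a subspace \<open>H\<close>.  A lower bound for the mean square of the averages of \<open>g\<close> over the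
  translates of \<open>S\<close> (\<open>energy_lower_bound\<close>) shows that \<open>H\<close> is not much smaller than \<open>S\<close>, and then the small variance on
  \<open>S\<close> passes to all cosets of \<open>H\<close> (\<open>stabiliser_of_pinned_cell\<close>).

  From the second round on, \<open>f\<close> and \<open>g\<close> differ, and a small error spread over all of \<open>V\<close> could outweigh
  a sparse \<open>f\<close>.  To exclude this the iteration keeps a representation \<open>g x = (\<Sum>y. K y * f (x + y))\<close> with
  bounded \<open>(\<Sum>y. \<bar>K y\<bar>)\<close>, which bounds the mass of \<open>g\<close> by a multiple of that of \<open>f\<close>.  It survives a round
  because the operator that subtracts coset averages kills \<open>Z\<close>.
\<close>

section \<open>Characters of the cube\<close>

definition chi :: "bit vec \<Rightarrow> bit vec \<Rightarrow> real" where
  "chi r x = (-1) ^ of_bit (r \<bullet> x)"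

definition avg :: "'a set \<Rightarrow> ('a \<Rightarrow> real) \<Rightarrow> real" where
  "avg S F = (\<Sum>x\<in>S. F x) / real (card S)"

lemma of_bit_sign_add: "(-1 :: real) ^ of_bit (a + b :: bit) = (-1) ^ of_bit a * (-1) ^ of_bit b"
  by (cases a; cases b) auto

lemma chi_cases: "chi r x = 1 \<or> chi r x = -1"
  unfolding chi_def by (cases "r \<bullet> x") auto

lemma abs_chi [simp]: "\<bar>chi r x\<bar> = 1"
  using chi_cases[of r x] by auto

text \<open>The dimension is fixed once and for all in a locale, so that \<open>V\<close> and the notions below do not have to
mention it.\<close>

locale hypercube =
  fixes n :: nat
begin

abbreviation V :: "bit vec set" where "V \<equiv> carrier_vec n"

lemma finite_V [simp]: "finite V"
proof -
  have "(UNIV :: bit set) = {0, 1}" by (metis (full_types) UNIV_eq_I bit.exhaust insertCI)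
  then have fin: "finite (UNIV :: bit set)" by (metis finite.emptyI finite.insertI)
  have "V \<subseteq> (\<lambda>f. vec n f) ` ({..<n} \<rightarrow>\<^sub>E UNIV)"
  proof
    fix x :: "bit vec" assume "x \<in> V"
    then have eq: "vec n (restrict (\<lambda>i. x $ i) {..<n}) = x" by auto
    have "vec n (restrict (\<lambda>i. x $ i) {..<n}) \<in> (\<lambda>f. vec n f) ` ({..<n} \<rightarrow>\<^sub>E UNIV)"
      by (rule imageI) (auto simp: PiE_iff extensional_def)
    then show "x \<in> (\<lambda>f. vec n f) ` ({..<n} \<rightarrow>\<^sub>E UNIV)" unfolding eq .
  qed
  then show ?thesis
    by (rule finite_subset) (intro finite_imageI finite_PiE, use fin in auto)
qed

lemma card_V_pos [simp]: "0 < card V"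
proof -
  have "0\<^sub>v n \<in> V" by simp
  then have "V \<noteq> {}" by blast
  then show ?thesis by (simp only: card_gt_0_iff finite_V) simp
qed

lemma add_self [simp]: "x \<in> V \<Longrightarrow> x + x = 0\<^sub>v n" for x :: "bit vec"
  by (intro eq_vecI) auto

lemma add_add_self [simp]: "x \<in> V \<Longrightarrow> y \<in> V \<Longrightarrow> x + (x + y) = y" for x :: "bit vec"
  by (metis add_self assoc_add_vec left_zero_vec)

lemma add_eq_swap: "x \<in> V \<Longrightarrow> y \<in> V \<Longrightarrow> z \<in> V \<Longrightarrow> x + y = z \<longleftrightarrow> y = x + z" for x :: "bit vec"
  by auto

lemma chi_sym: "r \<in> V \<Longrightarrow> x \<in> V \<Longrightarrow> chi r x = chi x r"
  unfolding chi_def by (metis comm_scalar_prod)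

lemma chi_add: "r \<in> V \<Longrightarrow> x \<in> V \<Longrightarrow> y \<in> V \<Longrightarrow> chi r (x + y) = chi r x * chi r y"
  unfolding chi_def by (simp add: scalar_prod_add_distrib of_bit_sign_add)

lemma chi_add_left: "r \<in> V \<Longrightarrow> s \<in> V \<Longrightarrow> x \<in> V \<Longrightarrow> chi (r + s) x = chi r x * chi s x"
  unfolding chi_def by (simp add: add_scalar_prod_distrib of_bit_sign_add)

lemma chi_zero [simp]: "r \<in> V \<Longrightarrow> chi r (0\<^sub>v n) = 1" "x \<in> V \<Longrightarrow> chi (0\<^sub>v n) x = 1"
  unfolding chi_def by auto

lemma sum_translate:
  assumes "t \<in> V" shows "(\<Sum>x\<in>V. F (t + x)) = (\<Sum>x\<in>V. F x)"
  by (rule sum.reindex_bij_witness[where i = "\<lambda>x. t + x" and j = "\<lambda>x. t + x"]) (use assms in auto)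

lemma sum_chi:
  assumes r: "r \<in> V"
  shows "(\<Sum>x\<in>V. chi r x) = (if r = 0\<^sub>v n then real (card V) else 0)"
proof (cases "r = 0\<^sub>v n")
  case False
  then obtain i where i: "i < n" "r $ i \<noteq> 0"
    using r by (metis carrier_vecD eq_vecI index_zero_vec(1) index_zero_vec(2))
  have "chi r (unit_vec n i) = -1"
    unfolding chi_def using r i by (simp add: scalar_prod_right_unit)
  then have "(\<Sum>x\<in>V. chi r (unit_vec n i + x)) = - (\<Sum>x\<in>V. chi r x)"
    using r by (simp add: chi_add sum_negf)
  then show ?thesis using sum_translate[of "unit_vec n i" "chi r"] False by simp
qed (use r in simp)

lemma sum_chi_mult:
  assumes "r \<in> V" "s \<in> V"
  shows "(\<Sum>x\<in>V. chi r x * chi s x) = (if r = s then real (card V) else 0)"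
proof -
  have "(\<Sum>x\<in>V. chi r x * chi s x) = (\<Sum>x\<in>V. chi (r + s) x)"
    using assms by (intro sum.cong) (auto simp: chi_add_left)
  moreover have "r + s = 0\<^sub>v n \<longleftrightarrow> r = s"
    using assms add_eq_swap[of r s "0\<^sub>v n"] by auto
  ultimately show ?thesis using assms sum_chi[of "r + s"] by simp
qed

lemma fourier_inversion:
  assumes x: "x \<in> V"
  shows "f x = (\<Sum>r\<in>V. fourier_transform n f r * chi r x)"
proof -
  have "(\<Sum>r\<in>V. fourier_transform n f r * chi r x)
      = (\<Sum>r\<in>V. \<Sum>y\<in>V. f y * (chi r y * chi r x) / card V)"
    unfolding fourier_transform_def monoid_vec_simps chi_def[symmetric]
    by (simp add: sum_divide_distrib sum_distrib_right sum_distrib_left mult_ac)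
  also have "\<dots> = (\<Sum>y\<in>V. \<Sum>r\<in>V. f y * (chi r y * chi r x) / card V)"
    by (rule sum.swap)
  also have "\<dots> = (\<Sum>y\<in>V. f y / card V * (\<Sum>r\<in>V. chi y r * chi x r))"
    using x by (auto simp: sum_distrib_left chi_sym intro!: sum.cong)
  also have "\<dots> = (\<Sum>y\<in>V. if y = x then f y else 0)"
    using x by (intro sum.cong) (auto simp: sum_chi_mult)
  finally show ?thesis using x by simp
qed

lemma parseval:
  fixes c :: "bit vec \<Rightarrow> real"
  shows
  "(\<Sum>t\<in>V. (\<Sum>r\<in>V. c r * chi r t)\<^sup>2) = card V * (\<Sum>r\<in>V. (c r)\<^sup>2)"
proof -
  have "(\<Sum>t\<in>V. (\<Sum>r\<in>V. c r * chi r t)\<^sup>2)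
      = (\<Sum>t\<in>V. \<Sum>r\<in>V. \<Sum>s\<in>V. c r * c s * (chi r t * chi s t))"
    by (simp add: power2_eq_square sum_product mult_ac)
  also have "\<dots> = (\<Sum>r\<in>V. \<Sum>t\<in>V. \<Sum>s\<in>V. c r * c s * (chi r t * chi s t))"
    by (rule sum.swap)
  also have "\<dots> = (\<Sum>r\<in>V. \<Sum>s\<in>V. \<Sum>t\<in>V. c r * c s * (chi r t * chi s t))"
    by (intro sum.cong refl sum.swap)
  also have "\<dots> = (\<Sum>r\<in>V. \<Sum>s\<in>V. if r = s then card V * (c r)\<^sup>2 else 0)"
    by (intro sum.cong refl) (auto simp: sum_distrib_left[symmetric] sum_chi_mult power2_eq_square)
  finally show ?thesis by (simp add: sum_distrib_left)
qed

text \<open>This is Parseval for the density of \<open>S\<close>, with the roles of points and characters exchanged.\<close>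

lemma sum_avg_chi_square:
  assumes S: "S \<subseteq> V" "S \<noteq> {}"
  shows "(\<Sum>r\<in>V. (avg S (chi r))\<^sup>2) = card V / card S"
proof -
  have fin: "finite S" using S(1) finite_V by (rule finite_subset)
  have cS: "card S > 0" using fin S by (simp add: card_gt_0_iff)
  have eq: "(\<Sum>x\<in>S. chi r x) = (\<Sum>x\<in>V. of_bool (x \<in> S) * chi x r)" if "r \<in> V" for r
  proof -
    have "(\<Sum>x\<in>V. of_bool (x \<in> S) * chi x r) = (\<Sum>x\<in>V. if x \<in> S then chi x r else 0)"
      by (intro sum.cong) auto
    also have "\<dots> = (\<Sum>x\<in>V \<inter> S. chi x r)" by (simp add: sum.inter_restrict)
    also have "\<dots> = (\<Sum>x\<in>S. chi r x)"
      using S that by (intro sum.cong) (auto intro: chi_sym)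
    finally show ?thesis by simp
  qed
  have "(\<Sum>r\<in>V. (\<Sum>x\<in>S. chi r x)\<^sup>2) = (\<Sum>r\<in>V. (\<Sum>x\<in>V. of_bool (x \<in> S) * chi x r)\<^sup>2)"
    by (intro sum.cong refl) (simp add: eq)
  also have "\<dots> = card V * (\<Sum>x\<in>V. (of_bool (x \<in> S))\<^sup>2 :: real)" by (rule parseval)
  also have "(\<Sum>x\<in>V. (of_bool (x \<in> S))\<^sup>2 :: real) = (\<Sum>x\<in>V. if x \<in> S then 1 else 0)"
    by (intro sum.cong) auto
  also have "\<dots> = card (V \<inter> S)" by (simp add: sum.inter_restrict[symmetric])
  also have "V \<inter> S = S" using S by auto
  finally show ?thesis using cS
    by (simp add: avg_def power_divide sum_divide_distrib[symmetric] power2_eq_square)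
qed

end

section \<open>Pinning characters by an energy increment\<close>

text \<open>Two points have the same pattern iff they lie in the same coset of the common
kernel of the characters in \<open>rs\<close>.\<close>

definition sign_pattern :: "bit vec list \<Rightarrow> bit vec \<Rightarrow> bool list" where
  "sign_pattern rs x = map (\<lambda>r. chi r x = 1) rs"

definition cell :: "bit vec set \<Rightarrow> bit vec list \<Rightarrow> bool list \<Rightarrow> bit vec set" where
  "cell S rs l = {x \<in> S. sign_pattern rs x = l}"

text \<open>The covariance of two characters under the uniform distribution on \<open>S\<close>.\<close>

definition cov :: "bit vec set \<Rightarrow> bit vec \<Rightarrow> bit vec \<Rightarrow> real" where
  "cov S r s = avg S (\<lambda>x. chi r x * chi s x) - avg S (chi r) * avg S (chi s)"

abbreviation labels :: "nat \<Rightarrow> bool list set" where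
  "labels k \<equiv> {l. length l = k}"

lemma finite_labels [simp]: "finite (labels k)"
  using finite_lists_length_eq[of "UNIV :: bool set" k] by simp

lemma card_labels [simp]: "card (labels k) = 2 ^ k"
  using card_lists_length_eq[of "UNIV :: bool set" k] by simp

lemma sum_labels_Suc:
  "(\<Sum>l\<in>labels (Suc k). F l) = (\<Sum>l\<in>labels k. F (True # l) + F (False # l) :: real)"
proof -
  have eq: "labels (Suc k) = (#) True ` labels k \<union> (#) False ` labels k"
    by (auto simp: length_Suc_conv)
  have "(\<Sum>l\<in>labels (Suc k). F l) = (\<Sum>l\<in>(#) True ` labels k. F l) + (\<Sum>l\<in>(#) False ` labels k. F l)"
    unfolding eq by (rule sum.union_disjoint) auto
  then show ?thesis by (simp add: sum.reindex sum.distrib)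
qed

lemma cell_Cons:
  "cell S (s # rs) (True # l) = {x \<in> cell S rs l. chi s x = 1}"
  "cell S (s # rs) (False # l) = {x \<in> cell S rs l. chi s x \<noteq> 1}"
  by (auto simp: cell_def sign_pattern_def)

lemma cell_subset: "cell S rs l \<subseteq> S"
  by (auto simp: cell_def)

lemma finite_cell [simp]: "finite S \<Longrightarrow> finite (cell S rs l)"
  by (simp add: cell_def)

lemma sum_cells:
  assumes "finite S"
  shows "(\<Sum>l\<in>labels (length rs). \<Sum>x\<in>cell S rs l. F x) = (\<Sum>x\<in>S. F x)"
  unfolding cell_def by (rule sum.group) (use assms in \<open>auto simp: sign_pattern_def\<close>)

text \<open>Here \<open>p\<close>, \<open>q\<close> are the sizes of two halves and \<open>a\<close>, \<open>b\<close> the sums of a function over them.  With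
\<open>D = a * q - b * p\<close> the claim reduces to \<open>4 * p * q \<le> (p + q)\<^sup>2\<close>.\<close>

lemma energy_split_real:
  fixes a b p q :: real
  assumes "p \<ge> 0" "q \<ge> 0" "p = 0 \<Longrightarrow> a = 0" "q = 0 \<Longrightarrow> b = 0"
  shows "(a + b)\<^sup>2 / (p + q) + (p + q) * ((a - b) / (p + q) - (a + b) / (p + q) * ((p - q) / (p + q)))\<^sup>2
       \<le> a\<^sup>2 / p + b\<^sup>2 / q"
proof -
  consider "p = 0" "q = 0" | "p = 0" "q > 0" | "p > 0" "q = 0" | "p > 0" "q > 0"
    using assms(1,2) by linarith
  then show ?thesis
  proof cases
    case 4
    define D where "D = a * q - b * p"
    have eq1: "(a + b)\<^sup>2 / (p + q) = a\<^sup>2 / p + b\<^sup>2 / q - D\<^sup>2 / (p * q * (p + q))"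
    proof -
      have "a\<^sup>2 / p + b\<^sup>2 / q - (a + b)\<^sup>2 / (p + q) - D\<^sup>2 / (p * q * (p + q)) = 0"
        using 4 unfolding D_def by (simp add: divide_simps) (auto simp: algebra_simps power2_eq_square)
      then show ?thesis by linarith
    qed
    have eq2: "(a - b) / (p + q) - (a + b) / (p + q) * ((p - q) / (p + q)) = 2 * D / (p + q)\<^sup>2"
      using 4 unfolding D_def by (simp add: divide_simps power2_eq_square) (auto simp: algebra_simps)
    have "4 * (p * q) \<le> (p + q)\<^sup>2"
      using zero_le_power2[of "p - q"] by (simp add: power2_eq_square algebra_simps)
    then have "4 / (p + q)\<^sup>2 \<le> 1 / (p * q)"
      using 4 by (simp add: divide_simps)
    then have "D\<^sup>2 / (p + q) * (4 / (p + q)\<^sup>2) \<le> D\<^sup>2 / (p + q) * (1 / (p * q))"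
      using 4 by (intro mult_left_mono) auto
    moreover have "(p + q) * (2 * D / (p + q)\<^sup>2)\<^sup>2 = D\<^sup>2 / (p + q) * (4 / (p + q)\<^sup>2)"
      using 4 by (simp add: divide_simps power2_eq_square)
    ultimately have "(p + q) * (2 * D / (p + q)\<^sup>2)\<^sup>2 \<le> D\<^sup>2 / (p * q * (p + q))"
      by (simp add: mult_ac)
    then show ?thesis unfolding eq1 eq2 by linarith
  qed (use assms in \<open>auto simp: power2_eq_square field_simps\<close>)
qed

text \<open>Refining a partition by the sign \<open>y\<close> increases the energy \<open>(\<Sum>a\<in>S. x a)\<^sup>2 / card S\<close> by the part of the
variance of \<open>x\<close> that is explained by \<open>y\<close>, which is \<open>card S\<close> times the squared covariance divided by the
variance of \<open>y\<close>; the latter is at most \<open>1\<close>.\<close>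

lemma energy_split:
  fixes x y :: "'a \<Rightarrow> real"
  assumes fin: "finite S" and y: "\<And>a. a \<in> S \<Longrightarrow> y a = 1 \<or> y a = -1"
  defines "P \<equiv> {a \<in> S. y a = 1}" and "Q \<equiv> {a \<in> S. y a \<noteq> 1}"
  shows "(\<Sum>a\<in>S. x a)\<^sup>2 / card S + card S * (avg S (\<lambda>a. x a * y a) - avg S x * avg S y)\<^sup>2
       \<le> (\<Sum>a\<in>P. x a)\<^sup>2 / card P + (\<Sum>a\<in>Q. x a)\<^sup>2 / card Q"
proof -
  have split: "(\<Sum>a\<in>S. F a) = (\<Sum>a\<in>P. F a) + (\<Sum>a\<in>Q. F a)" for F :: "'a \<Rightarrow> real"
  proof -
    have "S = P \<union> Q" "P \<inter> Q = {}" "finite P" "finite Q" using fin by (auto simp: P_def Q_def)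
    then show ?thesis by (metis sum.union_disjoint)
  qed
  have c: "real (card S) = real (card P) + real (card Q)"
    using split[of "\<lambda>_. 1"] by simp
  have Pv: "(\<Sum>a\<in>P. F a * y a) = (\<Sum>a\<in>P. F a)" for F by (intro sum.cong) (auto simp: P_def)
  have "y a = -1" if "a \<in> Q" for a using y[of a] that by (auto simp: Q_def)
  then have Qv: "(\<Sum>a\<in>Q. F a * y a) = - (\<Sum>a\<in>Q. F a)" for F
    unfolding sum_negf[symmetric] by (intro sum.cong) auto
  have "(\<Sum>a\<in>S. y a) = real (card P) - real (card Q)"
    using split[of y] Pv[of "\<lambda>_. 1"] Qv[of "\<lambda>_. 1"] by simp
  moreover have "finite P" "finite Q" using fin by (auto simp: P_def Q_def)
  ultimately show ?thesis
    using energy_split_real[of "card P" "card Q" "\<Sum>a\<in>P. x a" "\<Sum>a\<in>Q. x a"]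
    unfolding avg_def split[of x] split[of "\<lambda>a. x a * y a"] Pv Qv c by auto
qed

context hypercube
begin

text \<open>Energy increment.  As long as some \<open>s\<close> violates the conclusion, prepending \<open>s\<close> to the list raises the
weighted energy \<open>\<Phi>\<close> by more than \<open>\<gamma> * card A\<close>, while \<open>\<Phi>\<close> never exceeds \<open>M * card A\<close>.  So a longest list
whose energy is at least its length times \<open>\<gamma> * card A\<close> cannot be extended.\<close>

lemma exists_pinning:
  fixes c :: "bit vec \<Rightarrow> real" and M \<gamma> :: real
  assumes A: "A \<subseteq> V" and c: "(\<Sum>r\<in>V. \<bar>c r\<bar>) \<le> M" and \<gamma>: "\<gamma> > 0"
  shows "\<exists>rs. set rs \<subseteq> V \<and> (A \<noteq> {} \<longrightarrow> length rs * \<gamma> \<le> M) \<and>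
    (\<forall>s\<in>V. (\<Sum>l\<in>labels (length rs). card (cell A rs l) * (\<Sum>r\<in>V. \<bar>c r\<bar> * (cov (cell A rs l) r s)\<^sup>2))
        \<le> \<gamma> * card A)"
proof (cases "A = {}")
  case True
  then show ?thesis by (intro exI[of _ "[]"]) (simp add: cell_def)
next
  case False
  have fin: "finite A" using A finite_V by (rule finite_subset)
  have cA: "card A > 0" using fin False by (simp add: card_gt_0_iff)
  define en where "en S r = (\<Sum>a\<in>S. chi r a)\<^sup>2 / card S" for S r
  define \<Phi> where "\<Phi> rs = (\<Sum>l\<in>labels (length rs). \<Sum>r\<in>V. \<bar>c r\<bar> * en (cell A rs l) r)" for rs
  define gain where "gain rs s = (\<Sum>l\<in>labels (length rs).
      card (cell A rs l) * (\<Sum>r\<in>V. \<bar>c r\<bar> * (cov (cell A rs l) r s)\<^sup>2))" for rs s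
  have en_le: "en S r \<le> card S" if "finite S" for S r
  proof -
    have "\<bar>\<Sum>a\<in>S. chi r a\<bar> \<le> (\<Sum>a\<in>S. \<bar>chi r a\<bar>)" by (rule sum_abs)
    then have "(\<Sum>a\<in>S. chi r a)\<^sup>2 \<le> (card S)\<^sup>2" by (simp add: abs_le_square_iff[symmetric])
    then show ?thesis unfolding en_def by (cases "card S = 0") (auto simp: field_simps power2_eq_square)
  qed
  have \<Phi>_le: "\<Phi> rs \<le> M * card A" for rs
  proof -
    have "\<Phi> rs \<le> (\<Sum>l\<in>labels (length rs). \<Sum>r\<in>V. \<bar>c r\<bar> * card (cell A rs l))"
      unfolding \<Phi>_def using fin by (intro sum_mono mult_left_mono en_le) auto
    also have "\<dots> = (\<Sum>r\<in>V. \<bar>c r\<bar>) * (\<Sum>l\<in>labels (length rs). real (card (cell A rs l)))"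
      by (simp add: sum_distrib_left[symmetric] sum_distrib_right[symmetric])
    also have "(\<Sum>l\<in>labels (length rs). real (card (cell A rs l))) = card A"
      using sum_cells[OF fin, where rs = rs and F = "\<lambda>_. 1 :: real"] by simp
    finally show ?thesis using c by (meson mult_right_mono of_nat_0_le_iff order_trans)
  qed
  have \<Phi>_step: "\<Phi> (s # rs) \<ge> \<Phi> rs + gain rs s" for s rs
  proof -
    have "\<Phi> rs + gain rs s = (\<Sum>l\<in>labels (length rs). \<Sum>r\<in>V. \<bar>c r\<bar> *
        (en (cell A rs l) r + card (cell A rs l) * (cov (cell A rs l) r s)\<^sup>2))"
      unfolding \<Phi>_def gain_def by (simp add: sum.distrib distrib_left sum_distrib_left mult_ac)
    also have "\<dots> \<le> (\<Sum>l\<in>labels (length rs). \<Sum>r\<in>V. \<bar>c r\<bar> *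
        (en (cell A (s # rs) (True # l)) r + en (cell A (s # rs) (False # l)) r))"
      unfolding en_def cov_def cell_Cons
      by (intro sum_mono mult_left_mono energy_split) (use fin chi_cases in auto)
    also have "\<dots> = \<Phi> (s # rs)"
      unfolding \<Phi>_def by (simp add: sum_labels_Suc sum.distrib distrib_left)
    finally show ?thesis .
  qed
  define good where "good k \<longleftrightarrow> (\<exists>rs. set rs \<subseteq> V \<and> length rs = k \<and> k * \<gamma> * card A \<le> \<Phi> rs)" for k :: nat
  have bound: "k * \<gamma> \<le> M" if "good k" for k
  proof -
    from that obtain rs where "k * \<gamma> * card A \<le> \<Phi> rs" by (auto simp: good_def)
    then have "k * \<gamma> * card A \<le> M * card A" using \<Phi>_le[of rs] by linarith
    then show ?thesis using cA by simp
  qed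
  have "good 0"
    unfolding good_def \<Phi>_def en_def by (intro exI[of _ "[]"]) (auto intro!: sum_nonneg)
  moreover have "\<forall>k. good k \<longrightarrow> k \<le> nat \<lceil>M / \<gamma>\<rceil>"
  proof (intro allI impI)
    fix k assume "good k"
    then have "k \<le> M / \<gamma>" using bound \<gamma> by (simp add: field_simps)
    then show "k \<le> nat \<lceil>M / \<gamma>\<rceil>" by linarith
  qed
  ultimately obtain k where k: "good k" and max: "\<And>k'. good k' \<Longrightarrow> k' \<le> k"
    using ex_has_greatest_nat[of good 0 "\<lambda>k. k"] by (metis le_less_Suc_eq less_Suc_eq_le)
  from k obtain rs where rs: "set rs \<subseteq> V" "length rs = k" "k * \<gamma> * card A \<le> \<Phi> rs"
    by (auto simp: good_def)
  have "gain rs s \<le> \<gamma> * card A" if s: "s \<in> V" for s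
  proof (rule ccontr)
    assume "\<not> gain rs s \<le> \<gamma> * card A"
    then have "\<Phi> (s # rs) \<ge> k * \<gamma> * card A + \<gamma> * card A"
      using \<Phi>_step[of rs s] rs by linarith
    then have "good (Suc k)"
      unfolding good_def using rs s by (intro exI[of _ "s # rs"]) (auto simp: algebra_simps)
    then show False using max by force
  qed
  then show ?thesis using rs bound[OF k] unfolding gain_def by blast
qed

text \<open>A cell can be bad in three ways: its characters are too correlated, it carries too much of the mass of
\<open>g\<close>, or it is too small.  Cells of each kind make up at most a quarter of \<open>A\<close>, so one cell is good in all
three respects.\<close>

lemma exists_pinned_cell:
  fixes c g :: "bit vec \<Rightarrow> real" and M \<gamma> B :: real
  assumes A: "A \<subseteq> V" "A \<noteq> {}" and c: "(\<Sum>r\<in>V. \<bar>c r\<bar>) \<le> M" and \<gamma>: "\<gamma> > 0" and M: "M > 0"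
    and B: "B > 0" and g: "(\<Sum>x\<in>V. \<bar>g x\<bar>) \<le> B * card A"
  obtains rs l where "set rs \<subseteq> V" "length rs * \<gamma> \<le> M" "cell A rs l \<noteq> {}"
    "card A \<le> 4 * 2 ^ length rs * real (card (cell A rs l))"
    "(\<Sum>x\<in>cell V rs l. \<bar>g x\<bar>) \<le> 4 * B * card (cell A rs l)"
    "(\<Sum>r\<in>V. \<Sum>s\<in>V. \<bar>c r\<bar> * \<bar>c s\<bar> * (cov (cell A rs l) r s)\<^sup>2) \<le> 4 * M * \<gamma>"
proof -
  have fin: "finite A" using A(1) finite_V by (rule finite_subset)
  have cA: "card A > 0" using fin A by (simp add: card_gt_0_iff)
  obtain rs where rs: "set rs \<subseteq> V" "length rs * \<gamma> \<le> M" and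
    gain: "\<And>s. s \<in> V \<Longrightarrow> (\<Sum>l\<in>labels (length rs). card (cell A rs l) * (\<Sum>r\<in>V. \<bar>c r\<bar> * (cov (cell A rs l) r s)\<^sup>2))
        \<le> \<gamma> * card A"
    using exists_pinning[OF A(1) c \<gamma>] A(2) by blast
  define L where "L = labels (length rs)"
  define m where "m l = real (card (cell A rs l))" for l
  define X where "X l = (\<Sum>r\<in>V. \<Sum>s\<in>V. \<bar>c r\<bar> * \<bar>c s\<bar> * (cov (cell A rs l) r s)\<^sup>2)" for l
  define Y where "Y l = (\<Sum>x\<in>cell V rs l. \<bar>g x\<bar>)" for l
  have sum_m: "(\<Sum>l\<in>L. m l) = card A"
    unfolding L_def m_def using sum_cells[OF fin, where rs = rs and F = "\<lambda>_. 1 :: real"] by simp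
  have "(\<Sum>l\<in>L. m l * X l) = (\<Sum>l\<in>L. \<Sum>s\<in>V. \<Sum>r\<in>V. m l * (\<bar>c r\<bar> * \<bar>c s\<bar> * (cov (cell A rs l) r s)\<^sup>2))"
    unfolding X_def by (subst sum.swap) (simp add: sum_distrib_left)
  also have "\<dots> = (\<Sum>s\<in>V. \<Sum>l\<in>L. \<Sum>r\<in>V. m l * (\<bar>c r\<bar> * \<bar>c s\<bar> * (cov (cell A rs l) r s)\<^sup>2))"
    by (rule sum.swap)
  also have "\<dots> = (\<Sum>s\<in>V. \<bar>c s\<bar> * (\<Sum>l\<in>L. m l * (\<Sum>r\<in>V. \<bar>c r\<bar> * (cov (cell A rs l) r s)\<^sup>2)))"
    by (simp add: sum_distrib_left mult_ac)
  also have "\<dots> \<le> (\<Sum>s\<in>V. \<bar>c s\<bar> * (\<gamma> * card A))"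
    unfolding m_def L_def by (intro sum_mono mult_left_mono gain) auto
  also have "\<dots> \<le> M * (\<gamma> * card A)"
    unfolding sum_distrib_right[symmetric] using c \<gamma> by (intro mult_right_mono) auto
  finally have sum_X: "(\<Sum>l\<in>L. m l * X l) \<le> M * \<gamma> * card A" by (simp add: mult_ac)
  have sum_Y: "(\<Sum>l\<in>L. Y l) \<le> B * card A"
    unfolding Y_def L_def using g by (simp add: sum_cells)
  have "\<exists>l\<in>L. m l > m l * X l / (4 * M * \<gamma>) + Y l / (4 * B) + card A / (4 * 2 ^ length rs)"
  proof (rule ccontr)
    assume "\<not> ?thesis"
    then have "(\<Sum>l\<in>L. m l) \<le> (\<Sum>l\<in>L. m l * X l / (4 * M * \<gamma>) + Y l / (4 * B) + card A / (4 * 2 ^ length rs))"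
      by (intro sum_mono) force
    also have "\<dots> = (\<Sum>l\<in>L. m l * X l) / (4 * M * \<gamma>) + (\<Sum>l\<in>L. Y l) / (4 * B) + card A / 4"
      unfolding L_def by (simp add: sum.distrib sum_divide_distrib)
    also have "\<dots> \<le> M * \<gamma> * card A / (4 * M * \<gamma>) + B * card A / (4 * B) + card A / 4"
      using sum_X sum_Y M \<gamma> B by (intro add_mono divide_right_mono) auto
    also have "\<dots> = 3 / 4 * card A" using M \<gamma> B by simp
    finally show False using sum_m cA by simp
  qed
  then obtain l where l: "m l > m l * X l / (4 * M * \<gamma>) + Y l / (4 * B) + card A / (4 * 2 ^ length rs)" by blast
  have X0: "X l \<ge> 0" unfolding X_def by (intro sum_nonneg) auto
  have Y0: "Y l \<ge> 0" unfolding Y_def by (intro sum_nonneg) auto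
  have m0: "m l \<ge> 0" unfolding m_def by simp
  have p1: "m l * X l / (4 * M * \<gamma>) \<ge> 0" and p2: "Y l / (4 * B) \<ge> 0"
    and p3: "card A / (4 * 2 ^ length rs) > 0"
    using X0 Y0 m0 M \<gamma> B cA by auto
  have mpos: "m l > 0" using l p1 p2 p3 by linarith
  have "m l * X l / (4 * M * \<gamma>) \<le> m l" using l p1 p2 p3 by linarith
  then have "m l * X l \<le> m l * (4 * M * \<gamma>)" using M \<gamma> by (simp add: field_simps)
  then have XX: "X l \<le> 4 * M * \<gamma>" using mpos by simp
  have "Y l / (4 * B) \<le> m l" using l p1 p2 p3 by linarith
  then have YY: "Y l \<le> 4 * B * m l" using B by (simp add: field_simps)
  have "card A / (4 * 2 ^ length rs) \<le> m l" using l p1 p2 p3 by linarith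
  then have "real (card A) \<le> 4 * 2 ^ length rs * m l" by (simp add: field_simps)
  moreover have "cell A rs l \<noteq> {}" using mpos unfolding m_def by auto
  ultimately show ?thesis
    using that[of rs l] rs XX YY unfolding X_def Y_def m_def by blast
qed

text \<open>The variance of \<open>a \<mapsto> g (t + a)\<close> on \<open>S\<close> is the sum of the terms
\<open>c r * c s * chi r t * chi s t * cov S r s\<close>.  The translation \<open>t\<close> enters only through signs, which is why a
single hypothesis on the covariances serves all translates.\<close>

lemma variance_of_translates:
  fixes c g :: "bit vec \<Rightarrow> real" and M \<theta> :: real
  assumes g: "\<And>x. x \<in> V \<Longrightarrow> g x = (\<Sum>r\<in>V. c r * chi r x)"
    and c: "(\<Sum>r\<in>V. \<bar>c r\<bar>) \<le> M" and M: "M > 0" and \<theta>: "\<theta> > 0"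
    and S: "S \<subseteq> V" "S \<noteq> {}"
    and X: "(\<Sum>r\<in>V. \<Sum>s\<in>V. \<bar>c r\<bar> * \<bar>c s\<bar> * (cov S r s)\<^sup>2) \<le> \<theta>\<^sup>2 / M\<^sup>2"
    and t: "t \<in> V"
  shows "(\<Sum>a\<in>S. (g (t + a) - avg S (\<lambda>a. g (t + a)))\<^sup>2) \<le> \<theta> * card S"
proof -
  have fin: "finite S" using S(1) finite_V by (rule finite_subset)
  have cS: "card S > 0" using fin S by (simp add: card_gt_0_iff)
  define \<nu> where "\<nu> = \<theta> / M\<^sup>2"
  have \<nu>: "\<nu> > 0" using M \<theta> by (simp add: \<nu>_def)
  define F where "F a = g (t + a)" for a
  define d where "d r = c r * chi r t" for r
  have F: "F a = (\<Sum>r\<in>V. d r * chi r a)" if "a \<in> S" for a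
    unfolding F_def d_def using that S t by (auto simp: g chi_add mult_ac intro!: sum.cong)
  have avgF: "avg S F = (\<Sum>r\<in>V. d r * avg S (chi r))"
  proof -
    have "(\<Sum>a\<in>S. F a) = (\<Sum>a\<in>S. \<Sum>r\<in>V. d r * chi r a)" by (simp add: F)
    also have "\<dots> = (\<Sum>r\<in>V. d r * (\<Sum>a\<in>S. chi r a))" by (subst sum.swap) (simp add: sum_distrib_left)
    finally show ?thesis unfolding avg_def by (simp add: sum_divide_distrib[of _ V])
  qed
  have avgFF: "avg S (\<lambda>a. (F a)\<^sup>2) = (\<Sum>r\<in>V. \<Sum>s\<in>V. d r * d s * avg S (\<lambda>a. chi r a * chi s a))"
  proof -
    have "(\<Sum>a\<in>S. (F a)\<^sup>2) = (\<Sum>a\<in>S. \<Sum>r\<in>V. \<Sum>s\<in>V. d r * d s * (chi r a * chi s a))"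
      by (simp add: F power2_eq_square sum_product mult_ac)
    also have "\<dots> = (\<Sum>r\<in>V. \<Sum>a\<in>S. \<Sum>s\<in>V. d r * d s * (chi r a * chi s a))" by (rule sum.swap)
    also have "\<dots> = (\<Sum>r\<in>V. \<Sum>s\<in>V. \<Sum>a\<in>S. d r * d s * (chi r a * chi s a))"
      by (intro sum.cong refl sum.swap)
    also have "\<dots> = (\<Sum>r\<in>V. \<Sum>s\<in>V. d r * d s * (\<Sum>a\<in>S. chi r a * chi s a))"
      by (simp add: sum_distrib_left)
    finally show ?thesis unfolding avg_def by (simp add: sum_divide_distrib[of _ V])
  qed
  have "(\<Sum>a\<in>S. (F a - avg S F)\<^sup>2) = (\<Sum>a\<in>S. (F a)\<^sup>2) - 2 * avg S F * (\<Sum>a\<in>S. F a) + card S * (avg S F)\<^sup>2"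
    by (simp add: power2_diff sum.distrib sum_subtractf sum_distrib_left sum_distrib_right mult_ac)
  also have "(\<Sum>a\<in>S. F a) = card S * avg S F" using cS by (simp add: avg_def)
  also have "(\<Sum>a\<in>S. (F a)\<^sup>2) = card S * avg S (\<lambda>a. (F a)\<^sup>2)" using cS by (simp add: avg_def)
  finally have "(\<Sum>a\<in>S. (F a - avg S F)\<^sup>2) = card S * (avg S (\<lambda>a. (F a)\<^sup>2) - (avg S F)\<^sup>2)"
    by (simp add: power2_eq_square algebra_simps)
  also have "avg S (\<lambda>a. (F a)\<^sup>2) - (avg S F)\<^sup>2 = (\<Sum>r\<in>V. \<Sum>s\<in>V. d r * d s * cov S r s)"
    unfolding avgF avgFF cov_def
    by (simp add: power2_eq_square sum_product right_diff_distrib sum_subtractf mult_ac)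
  also have "\<dots> \<le> (\<Sum>r\<in>V. \<Sum>s\<in>V. \<bar>c r\<bar> * \<bar>c s\<bar> * (\<nu> / 2 + (cov S r s)\<^sup>2 / (2 * \<nu>)))"
  proof (rule sum_mono, rule sum_mono)
    fix r s
    let ?v = "\<bar>cov S r s\<bar>"
    \<comment> \<open>The weighted mean of the squared covariance bounds that of its absolute value; \<open>\<nu>\<close> is the value that balances the two terms.\<close>
    have "0 \<le> (\<nu> - ?v)\<^sup>2" by simp
    then have "2 * \<nu> * ?v \<le> \<nu>\<^sup>2 + (cov S r s)\<^sup>2" by (simp add: power2_diff)
    then have v: "?v \<le> \<nu> / 2 + (cov S r s)\<^sup>2 / (2 * \<nu>)"
      using \<nu> by (simp add: field_simps power2_eq_square)
    have "d r * d s * cov S r s \<le> \<bar>d r * d s * cov S r s\<bar>" by simp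
    also have "\<dots> = \<bar>c r\<bar> * \<bar>c s\<bar> * ?v" by (simp add: d_def abs_mult)
    also have "\<dots> \<le> \<bar>c r\<bar> * \<bar>c s\<bar> * (\<nu> / 2 + (cov S r s)\<^sup>2 / (2 * \<nu>))"
      using v by (rule mult_left_mono) simp
    finally show "d r * d s * cov S r s \<le> \<bar>c r\<bar> * \<bar>c s\<bar> * (\<nu> / 2 + (cov S r s)\<^sup>2 / (2 * \<nu>))" .
  qed
  also have "\<dots> = (\<Sum>r\<in>V. \<bar>c r\<bar>)\<^sup>2 * (\<nu> / 2) +
      (\<Sum>r\<in>V. \<Sum>s\<in>V. \<bar>c r\<bar> * \<bar>c s\<bar> * (cov S r s)\<^sup>2) / (2 * \<nu>)"
  proof -
    have "(\<Sum>r\<in>V. \<bar>c r\<bar>)\<^sup>2 = (\<Sum>r\<in>V. \<Sum>s\<in>V. \<bar>c r\<bar> * \<bar>c s\<bar>)"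
      by (simp only: power2_eq_square sum_product)
    then show ?thesis
      by (simp only: sum_distrib_right sum_divide_distrib sum.distrib distrib_left times_divide_eq_right)
  qed
  also have "\<dots> \<le> M\<^sup>2 * (\<nu> / 2) + \<theta>\<^sup>2 / M\<^sup>2 / (2 * \<nu>)"
  proof (intro add_mono mult_right_mono divide_right_mono X)
    show "(\<Sum>r\<in>V. \<bar>c r\<bar>)\<^sup>2 \<le> M\<^sup>2" using c by (rule power_mono) (simp add: sum_nonneg)
  qed (use \<nu> in simp_all)
  also have "\<dots> = \<theta>" using M \<theta> by (simp add: \<nu>_def field_simps power2_eq_square)
  finally show ?thesis unfolding F_def using cS by (simp add: mult_ac)
qed

end

section \<open>Concentration near integers\<close>

lemma avg_minimises_variance:
  assumes "finite S"
  shows "(\<Sum>a\<in>S. (F a - avg S F)\<^sup>2) \<le> (\<Sum>a\<in>S. (F a - q)\<^sup>2)"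
proof (cases "card S = 0")
  case False
  define m where "m = avg S F"
  have m: "(\<Sum>a\<in>S. F a) = card S * m" using False by (simp add: m_def avg_def)
  have "(\<Sum>a\<in>S. (F a - q)\<^sup>2) - (\<Sum>a\<in>S. (F a - m)\<^sup>2) = (\<Sum>a\<in>S. (m - q) * (2 * F a - m - q))"
    unfolding sum_subtractf[symmetric] by (intro sum.cong) (auto simp: power2_eq_square algebra_simps)
  also have "\<dots> = (m - q) * (2 * (\<Sum>a\<in>S. F a) - card S * m - card S * q)"
    by (simp add: sum_distrib_left[symmetric] sum_subtractf)
  also have "\<dots> = card S * (m - q)\<^sup>2" unfolding m by (simp add: power2_eq_square algebra_simps)
  finally have "(\<Sum>a\<in>S. (F a - q)\<^sup>2) - (\<Sum>a\<in>S. (F a - m)\<^sup>2) \<ge> 0" by simp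
  then show ?thesis by (simp add: m_def)
qed (use assms in auto)

lemma abs_avg_le:
  assumes "finite S" "\<And>a. a \<in> S \<Longrightarrow> \<bar>F a\<bar> \<le> M" "M \<ge> 0"
  shows "\<bar>avg S F\<bar> \<le> M"
proof -
  have "\<bar>\<Sum>a\<in>S. F a\<bar> \<le> (\<Sum>a\<in>S. \<bar>F a\<bar>)" by (rule sum_abs)
  also have "\<dots> \<le> card S * M" using sum_bounded_above[of S "\<lambda>a. \<bar>F a\<bar>" M] assms(2) by simp
  finally show ?thesis using assms(3) unfolding avg_def
    by (cases "card S = 0") (auto simp: field_simps abs_divide)
qed

lemma int_cases_abs: "(k :: real) \<in> \<int> \<Longrightarrow> k = 0 \<or> \<bar>k\<bar> \<ge> 1"
  by (elim Ints_cases) auto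

text \<open>If \<open>\<bar>u\<bar> \<ge> 1 / 2\<close>, then wherever \<open>\<phi>\<close> vanishes \<open>G\<close> is at distance at least \<open>3/8\<close> from \<open>u\<close>; if
\<open>\<bar>u\<bar> \<le> 1 / 2\<close>, the same holds wherever \<open>\<phi>\<close> does not vanish.  Chebyshev's inequality bounds how often this
can happen.\<close>

lemma concentration_dichotomy:
  fixes G \<phi> :: "'a \<Rightarrow> real" and u \<theta> \<epsilon> :: real
  assumes fin: "finite S" and int: "\<And>a. a \<in> S \<Longrightarrow> \<phi> a \<in> \<int>"
    and near: "\<And>a. a \<in> S \<Longrightarrow> \<bar>\<phi> a - G a\<bar> \<le> \<epsilon>" and \<epsilon>: "\<epsilon> \<le> 1 / 8"
    and var: "(\<Sum>a\<in>S. (G a - u)\<^sup>2) \<le> \<theta> * card S"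
  shows "\<bar>u\<bar> \<ge> 1 / 2 \<Longrightarrow> card {a \<in> S. \<phi> a = 0} \<le> 8 * \<theta> * card S"
    and "\<bar>u\<bar> \<le> 1 / 2 \<Longrightarrow> card {a \<in> S. \<phi> a \<noteq> 0} \<le> 8 * \<theta> * card S"
proof -
  have markov: "card T \<le> 8 * \<theta> * card S" if T: "T \<subseteq> S" "\<And>a. a \<in> T \<Longrightarrow> \<bar>G a - u\<bar> \<ge> 3 / 8" for T
  proof -
    have "card T * (1 / 8) \<le> (\<Sum>a\<in>T. (G a - u)\<^sup>2)"
    proof (rule sum_bounded_below[of T "1 / 8" "\<lambda>a. (G a - u)\<^sup>2"])
      fix a assume "a \<in> T"
      then have "(3 / 8)\<^sup>2 \<le> \<bar>G a - u\<bar>\<^sup>2" using T(2) by (intro power_mono) auto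
      then show "1 / 8 \<le> (G a - u)\<^sup>2" by (simp add: power2_eq_square)
    qed
    also have "\<dots> \<le> (\<Sum>a\<in>S. (G a - u)\<^sup>2)" using fin T(1) by (intro sum_mono2) auto
    finally show ?thesis using var by simp
  qed
  show "card {a \<in> S. \<phi> a = 0} \<le> 8 * \<theta> * card S" if u: "\<bar>u\<bar> \<ge> 1 / 2"
  proof (rule markov)
    fix a assume "a \<in> {a \<in> S. \<phi> a = 0}"
    then have "\<bar>G a\<bar> \<le> \<epsilon>" using near[of a] by auto
    then show "\<bar>G a - u\<bar> \<ge> 3 / 8" using u \<epsilon> by linarith
  qed auto
  show "card {a \<in> S. \<phi> a \<noteq> 0} \<le> 8 * \<theta> * card S" if u: "\<bar>u\<bar> \<le> 1 / 2"
  proof (rule markov)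
    fix a assume "a \<in> {a \<in> S. \<phi> a \<noteq> 0}"
    then have "\<bar>\<phi> a\<bar> \<ge> 1" "\<bar>\<phi> a - G a\<bar> \<le> \<epsilon>" using int_cases_abs[OF int] near by auto
    then show "\<bar>G a - u\<bar> \<ge> 3 / 8" using u \<epsilon> by linarith
  qed auto
qed

context hypercube
begin

section \<open>Functions of bounded spectral norm\<close>

text \<open>The spectral norm of \<open>g\<close> is at most \<open>M\<close>.  Fourier coefficients are unique, so asking for some coefficients
\<open>c\<close> is no weaker than prescribing them, and it is easier to check for functions built from others.\<close>

definition wiener :: "real \<Rightarrow> (bit vec \<Rightarrow> real) \<Rightarrow> bool" where
  "wiener M g \<longleftrightarrow> (\<exists>c. (\<Sum>r\<in>V. \<bar>c r\<bar>) \<le> M \<and> (\<forall>x\<in>V. g x = (\<Sum>r\<in>V. c r * chi r x)))"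

text \<open>Multiplication by \<open>chi r\<close> permutes the coefficients and keeps the norm; the function in question is the
average of \<open>h\<close> and \<open>\<sigma> * chi r * h\<close>.\<close>

lemma wiener_half:
  assumes h: "wiener M h" and r: "r \<in> V" and \<sigma>: "\<bar>\<sigma>\<bar> = 1"
  shows "wiener M (\<lambda>x. h x * (1 + \<sigma> * chi r x) / 2)"
proof -
  from h obtain c where c: "(\<Sum>s\<in>V. \<bar>c s\<bar>) \<le> M" and hx: "\<And>x. x \<in> V \<Longrightarrow> h x = (\<Sum>s\<in>V. c s * chi s x)"
    unfolding wiener_def by blast
  define d where "d s = (c s + \<sigma> * c (r + s)) / 2" for s
  have "(\<Sum>s\<in>V. \<bar>d s\<bar>) \<le> (\<Sum>s\<in>V. (\<bar>c s\<bar> + \<bar>c (r + s)\<bar>) / 2)"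
  proof (rule sum_mono)
    fix s
    have "\<bar>c s + \<sigma> * c (r + s)\<bar> \<le> \<bar>c s\<bar> + \<bar>\<sigma> * c (r + s)\<bar>" by (rule abs_triangle_ineq)
    then show "\<bar>d s\<bar> \<le> (\<bar>c s\<bar> + \<bar>c (r + s)\<bar>) / 2" using \<sigma> by (simp add: d_def abs_mult)
  qed
  also have "\<dots> = ((\<Sum>s\<in>V. \<bar>c s\<bar>) + (\<Sum>s\<in>V. \<bar>c (r + s)\<bar>)) / 2"
    by (simp add: sum.distrib sum_divide_distrib add_divide_distrib)
  also have "\<dots> \<le> M" using c sum_translate[OF r, of "\<lambda>s. \<bar>c s\<bar>"] by simp
  finally have dM: "(\<Sum>s\<in>V. \<bar>d s\<bar>) \<le> M" .
  have "h x * (1 + \<sigma> * chi r x) / 2 = (\<Sum>s\<in>V. d s * chi s x)" if x: "x \<in> V" for x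
  proof -
    have "(\<Sum>s\<in>V. c (r + s) * chi s x) = (\<Sum>s\<in>V. c (r + (r + s)) * chi (r + s) x)"
      using sum_translate[OF r, of "\<lambda>s. c (r + s) * chi s x"] by simp
    also have "\<dots> = chi r x * h x"
      using r x by (auto simp: hx chi_add_left sum_distrib_left intro!: sum.cong)
    finally have e: "(\<Sum>s\<in>V. c (r + s) * chi s x) = chi r x * h x" .
    have "(\<Sum>s\<in>V. d s * chi s x) = ((\<Sum>s\<in>V. c s * chi s x) + \<sigma> * (\<Sum>s\<in>V. c (r + s) * chi s x)) / 2"
      unfolding d_def sum_distrib_left sum.distrib[symmetric] sum_divide_distrib
      by (intro sum.cong) (auto simp: algebra_simps)
    then show ?thesis unfolding e hx[OF x, symmetric] by (simp add: algebra_simps)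
  qed
  then show ?thesis unfolding wiener_def using dM by blast
qed

lemma wiener_cong: "wiener M g \<Longrightarrow> (\<And>x. x \<in> V \<Longrightarrow> g x = h x) \<Longrightarrow> wiener M h"
  unfolding wiener_def by auto

lemma wiener_nonneg: "wiener M g \<Longrightarrow> 0 \<le> M"
  unfolding wiener_def by (meson abs_ge_zero order_trans sum_nonneg)

lemma wiener_abs_le:
  assumes "wiener M g" "x \<in> V" shows "\<bar>g x\<bar> \<le> M"
proof -
  from assms obtain c where c: "(\<Sum>s\<in>V. \<bar>c s\<bar>) \<le> M" "g x = (\<Sum>s\<in>V. c s * chi s x)"
    unfolding wiener_def by blast
  have "\<bar>g x\<bar> \<le> (\<Sum>s\<in>V. \<bar>c s * chi s x\<bar>)" unfolding c(2) by (rule sum_abs)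
  then show ?thesis using c(1) by (simp add: abs_mult)
qed

text \<open>A single character is cut off by \<open>wiener_half\<close>, since \<open>(1 \<plusminus> chi r x) / 2\<close> is the indicator of
\<open>chi r x = \<plusminus>1\<close>.\<close>

lemma wiener_restrict_cell:
  assumes g: "wiener M g"
  shows "set rs \<subseteq> V \<Longrightarrow> wiener M (\<lambda>x. if sign_pattern rs x = l then g x else 0)"
proof (induction rs arbitrary: l)
  case Nil
  have zero: "wiener M (\<lambda>x. 0)"
    unfolding wiener_def using wiener_nonneg[OF g] by (intro exI[of _ "\<lambda>_. 0"]) auto
  show ?case using g zero by (cases l) (auto simp: sign_pattern_def)
next
  case (Cons r rs)
  show ?case
  proof (cases l)
    case Nil
    then show ?thesis
      unfolding wiener_def using wiener_nonneg[OF g]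
      by (intro exI[of _ "\<lambda>_. 0"]) (auto simp: sign_pattern_def)
  next
    case l: (Cons b l')
    define \<sigma> :: real where "\<sigma> = (if b then 1 else -1)"
    have "wiener M (\<lambda>x. (if sign_pattern rs x = l' then g x else 0) * (1 + \<sigma> * chi r x) / 2)"
      using Cons by (intro wiener_half) (auto simp: \<sigma>_def)
    then show ?thesis
    proof (rule wiener_cong)
      fix x
      show "(if sign_pattern rs x = l' then g x else 0) * (1 + \<sigma> * chi r x) / 2 = (if sign_pattern (r # rs) x = l then g x else 0)"
        using chi_cases[of r x] by (auto simp: sign_pattern_def l \<sigma>_def)
    qed
  qed
qed

text \<open>With \<open>\<nu> r = avg S (chi r)\<close> one has \<open>avg S g = (\<Sum>r. c r * \<nu> r)\<close>.  Cauchy-Schwarz against the weights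
\<open>\<bar>c r\<bar>\<close> leads to \<open>\<Sum>r. \<bar>c r\<bar> * (\<nu> r)\<^sup>2\<close>, and a second application, using the known value of \<open>\<Sum>r. (\<nu> r)\<^sup>2\<close>, leads to
\<open>\<Sum>r. (c r * \<nu> r)\<^sup>2\<close>, which is the mean square of the averages over translates by Parseval.  Thus a large average
over \<open>S\<close> forces large averages over many translates of \<open>S\<close>.\<close>

lemma energy_lower_bound:
  assumes g: "wiener M g" and S: "S \<subseteq> V" "S \<noteq> {}"
  shows "card S * (avg S g) ^ 4 \<le> M\<^sup>2 * (\<Sum>t\<in>V. (avg S (\<lambda>a. g (t + a)))\<^sup>2)"
proof -
  have fin: "finite S" using S(1) finite_V by (rule finite_subset)
  have cS: "card S > 0" using fin S by (simp add: card_gt_0_iff)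
  from g obtain c where c: "(\<Sum>s\<in>V. \<bar>c s\<bar>) \<le> M" and gx: "\<And>x. x \<in> V \<Longrightarrow> g x = (\<Sum>s\<in>V. c s * chi s x)"
    unfolding wiener_def by blast
  define \<nu> where "\<nu> r = avg S (chi r)" for r
  have u: "avg S (\<lambda>a. g (t + a)) = (\<Sum>r\<in>V. (c r * \<nu> r) * chi r t)" if t: "t \<in> V" for t
  proof -
    have "(\<Sum>a\<in>S. g (t + a)) = (\<Sum>a\<in>S. \<Sum>r\<in>V. c r * chi r t * chi r a)"
      using S t by (intro sum.cong) (auto simp: gx chi_add mult_ac)
    also have "\<dots> = (\<Sum>r\<in>V. c r * chi r t * (\<Sum>a\<in>S. chi r a))"
      by (subst sum.swap) (simp add: sum_distrib_left)
    finally show ?thesis unfolding avg_def \<nu>_def by (simp add: sum_divide_distrib[of _ V] mult_ac)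
  qed
  have "avg S g = avg S (\<lambda>a. g (0\<^sub>v n + a))"
    unfolding avg_def using S by (intro arg_cong2[where f = "(/)"] sum.cong) auto
  also have "\<dots> = (\<Sum>r\<in>V. c r * \<nu> r)" by (simp add: u)
  finally have a0: "avg S g = (\<Sum>r\<in>V. c r * \<nu> r)" .
  define E where "E = (\<Sum>r\<in>V. \<bar>c r\<bar> * (\<nu> r)\<^sup>2)"
  have E0: "E \<ge> 0" unfolding E_def by (intro sum_nonneg) auto
  have "(avg S g)\<^sup>2 \<le> (\<Sum>r\<in>V. \<bar>c r\<bar> * \<bar>\<nu> r\<bar>)\<^sup>2"
  proof -
    have "\<bar>\<Sum>r\<in>V. c r * \<nu> r\<bar> \<le> (\<Sum>r\<in>V. \<bar>c r\<bar> * \<bar>\<nu> r\<bar>)"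
      using sum_abs[of "\<lambda>r. c r * \<nu> r" V] by (simp add: abs_mult)
    then show ?thesis unfolding a0 by (rule abs_le_square_iff[THEN iffD1, OF order_trans]) simp
  qed
  also have "\<dots> = (\<Sum>r\<in>V. sqrt \<bar>c r\<bar> * (sqrt \<bar>c r\<bar> * \<bar>\<nu> r\<bar>))\<^sup>2"
    by (simp add: mult.assoc[symmetric])
  also have "\<dots> \<le> (\<Sum>r\<in>V. (sqrt \<bar>c r\<bar>)\<^sup>2) * (\<Sum>r\<in>V. (sqrt \<bar>c r\<bar> * \<bar>\<nu> r\<bar>)\<^sup>2)"
    by (rule Cauchy_Schwarz_ineq_sum)
  also have "\<dots> = (\<Sum>r\<in>V. \<bar>c r\<bar>) * E" by (simp add: power_mult_distrib E_def)
  also have "\<dots> \<le> M * E" using c E0 by (rule mult_right_mono)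
  finally have "((avg S g)\<^sup>2)\<^sup>2 \<le> (M * E)\<^sup>2" by (intro power_mono) auto
  then have 1: "(avg S g) ^ 4 \<le> M\<^sup>2 * E\<^sup>2" by (simp add: power_mult_distrib)
  have "E\<^sup>2 = (\<Sum>r\<in>V. (\<bar>c r\<bar> * \<bar>\<nu> r\<bar>) * \<bar>\<nu> r\<bar>)\<^sup>2"
    unfolding E_def by (simp add: power2_eq_square mult.assoc)
  also have "\<dots> \<le> (\<Sum>r\<in>V. (\<bar>c r\<bar> * \<bar>\<nu> r\<bar>)\<^sup>2) * (\<Sum>r\<in>V. \<bar>\<nu> r\<bar>\<^sup>2)"
    by (rule Cauchy_Schwarz_ineq_sum)
  also have "\<dots> = (\<Sum>r\<in>V. (c r * \<nu> r)\<^sup>2) * (card V / card S)"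
    using sum_avg_chi_square[OF S] by (simp add: power_mult_distrib \<nu>_def)
  also have "\<dots> = (\<Sum>t\<in>V. (avg S (\<lambda>a. g (t + a)))\<^sup>2) / card S"
    using parseval[of "\<lambda>r. c r * \<nu> r"] by (simp add: u)
  finally have 2: "E\<^sup>2 \<le> (\<Sum>t\<in>V. (avg S (\<lambda>a. g (t + a)))\<^sup>2) / card S" .
  have "(avg S g) ^ 4 \<le> M\<^sup>2 * ((\<Sum>t\<in>V. (avg S (\<lambda>a. g (t + a)))\<^sup>2) / card S)"
    using 1 mult_left_mono[OF 2, of "M\<^sup>2"] by auto
  then show ?thesis using cS by (simp add: field_simps)
qed

section \<open>The stabiliser of a pinned cell\<close>

text \<open>In characteristic two every vector is its own inverse, so closure under addition already gives a subgroup.\<close>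

definition subspace :: "bit vec set \<Rightarrow> bool" where
  "subspace H \<longleftrightarrow> H \<subseteq> V \<and> 0\<^sub>v n \<in> H \<and> (\<forall>x\<in>H. \<forall>y\<in>H. x + y \<in> H)"

lemma inj_translate: "t \<in> V \<Longrightarrow> T \<subseteq> V \<Longrightarrow> inj_on (\<lambda>x. t + x) T"
  by (rule inj_on_inverseI[where g = "\<lambda>x. t + x"]) auto

lemma sum_translate_le:
  fixes F :: "bit vec \<Rightarrow> real"
  assumes "t \<in> V" "T \<subseteq> V" "U \<subseteq> V" "\<And>x. x \<in> T \<Longrightarrow> t + x \<in> U" "\<And>x. F x \<ge> 0"
  shows "(\<Sum>x\<in>T. F (t + x)) \<le> (\<Sum>x\<in>U. F x)"
proof -
  have "(\<Sum>x\<in>T. F (t + x)) = (\<Sum>x\<in>(\<lambda>x. t + x) ` T. F x)"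
    using inj_translate[OF assms(1,2)] by (simp add: sum.reindex)
  also have "\<dots> \<le> (\<Sum>x\<in>U. F x)"
    using assms finite_subset[OF assms(3) finite_V] by (intro sum_mono2) auto
  finally show ?thesis .
qed

lemma sign_pattern_add:
  assumes "set rs \<subseteq> V" "t \<in> V" "a \<in> V"
  shows "sign_pattern rs (t + a) = sign_pattern rs a \<longleftrightarrow> (\<forall>r\<in>set rs. chi r t = 1)"
proof -
  have "(chi r (t + a) = 1 \<longleftrightarrow> chi r a = 1) \<longleftrightarrow> chi r t = 1" if "r \<in> set rs" for r
    using chi_cases[of r t] chi_cases[of r a] chi_add[of r t a] assms that by auto
  then show ?thesis unfolding sign_pattern_def by (auto simp: map_eq_conv)
qed

text \<open>The cell \<open>S\<close> has the property that \<open>g\<close> has small variance on each of its translates.  Then the translations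
\<open>t\<close> that preserve the sign pattern and for which the average \<open>u t\<close> of \<open>g\<close> over \<open>t + S\<close> is not small are
exactly those that map almost all of \<open>S\<close> into itself; all others map almost none of \<open>S\<close> into itself.  Composing
two of the first kind never gives one of the second kind, so they form a subspace \<open>H\<close>.

The set \<open>H\<close> is large because \<open>u\<close> has a large mean square by \<open>energy_lower_bound\<close>, to which translations outside
\<open>H\<close> contribute little: there \<open>\<bar>u t\<bar>\<close> is tiny, and its sum is controlled by the mass of \<open>g\<close>.  Some coset \<open>a + H\<close>
lies almost entirely in \<open>S\<close> by double counting, and as it fills a fixed proportion of \<open>S\<close>, it inherits the
small variance, as do all its translates, which are all the cosets of \<open>H\<close>.\<close>

lemma stabiliser_of_pinned_cell:
  fixes f g :: "bit vec \<Rightarrow> real" and M B \<epsilon> \<theta> :: real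
  defines "A \<equiv> {x \<in> V. f x \<noteq> 0}"
  assumes f: "\<And>x. x \<in> V \<Longrightarrow> f x \<in> \<int>" and g: "wiener M g" and M: "M \<ge> 1"
    and near: "\<And>x. x \<in> V \<Longrightarrow> \<bar>f x - g x\<bar> \<le> \<epsilon>" and \<epsilon>: "0 \<le> \<epsilon>" "\<epsilon> \<le> 1 / 8"
    and rs: "set rs \<subseteq> V" and S_ne: "cell A rs l \<noteq> {}"
    and var: "\<And>t. t \<in> V \<Longrightarrow>
      (\<Sum>a\<in>cell A rs l. (g (t + a) - avg (cell A rs l) (\<lambda>a. g (t + a)))\<^sup>2) \<le> \<theta> * card (cell A rs l)"
    and mass: "(\<Sum>x\<in>cell V rs l. \<bar>g x\<bar>) \<le> 4 * B * card (cell A rs l)" and B: "B > 0"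
    and \<theta>: "0 < \<theta>" "\<theta> \<le> 1 / 128" and small: "(\<epsilon> + 8 * \<theta> * M) * (4 * B) \<le> 1 / (32 * M\<^sup>2)"
  shows "\<exists>H. subspace H \<and> card (cell A rs l) \<le> 32 * M ^ 4 * card H \<and>
    (\<forall>t\<in>V. \<exists>q. (\<Sum>h\<in>H. (g (t + h) - q)\<^sup>2) \<le> 64 * M ^ 4 * \<theta> * card H) \<and>
    (\<exists>a\<in>V. card H / 2 \<le> card {h \<in> H. f (a + h) \<noteq> 0})"
proof -
  define S where "S = cell A rs l"
  define u where "u t = avg S (\<lambda>a. g (t + a))" for t
  define \<eta> where "\<eta> = 8 * \<theta>"
  define W0 where "W0 = {t \<in> V. \<forall>r\<in>set rs. chi r t = 1}"
  define H where "H = {t \<in> W0. \<bar>u t\<bar> \<ge> 1 / 2}"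
  have S: "S \<subseteq> V" "S \<noteq> {}" "finite S"
  proof -
    show "S \<subseteq> V" unfolding S_def A_def cell_def by auto
    then show "finite S" using finite_V by (rule finite_subset)
    show "S \<noteq> {}" using S_ne by (simp add: S_def)
  qed
  have s: "card S > 0" using S by (simp add: card_gt_0_iff)
  have \<eta>: "\<eta> > 0" "\<eta> \<le> 1 / 16" using \<theta> by (auto simp: \<eta>_def)
  have W0V: "W0 \<subseteq> V" and HW: "H \<subseteq> W0" by (auto simp: W0_def H_def)
  have finH: "finite H" "finite W0" using W0V HW finite_V by (meson finite_subset)+
  have gM: "\<bar>g x\<bar> \<le> M" if "x \<in> V" for x using wiener_abs_le[OF g that] .
  have memS: "t + a \<in> S \<longleftrightarrow> f (t + a) \<noteq> 0" if "t \<in> W0" "a \<in> S" for t a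
  proof -
    have "sign_pattern rs (t + a) = sign_pattern rs a" using that rs S W0V by (subst sign_pattern_add) (auto simp: W0_def)
    then show ?thesis using that S W0V by (auto simp: S_def cell_def A_def)
  qed
  have fz: "f (t + a) \<in> \<int>" "\<bar>f (t + a) - g (t + a)\<bar> \<le> \<epsilon>" if "t \<in> V" "a \<in> S" for t a
    using f[of "t + a"] near[of "t + a"] that S(1) by auto
  have varS: "(\<Sum>a\<in>S. (g (t + a) - u t)\<^sup>2) \<le> \<theta> * card S" if "t \<in> V" for t
    using var[OF that] by (simp add: S_def u_def)
  have few_zeros: "card {a \<in> S. f (t + a) = 0} \<le> \<eta> * card S" if t: "t \<in> V" "\<bar>u t\<bar> \<ge> 1 / 2" for t
    unfolding \<eta>_def
    by (rule concentration_dichotomy(1)[OF S(3) fz(1)[OF t(1)] fz(2)[OF t(1)] \<epsilon>(2) varS[OF t(1)] t(2)])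
  have few_nonzeros: "card {a \<in> S. f (t + a) \<noteq> 0} \<le> \<eta> * card S" if t: "t \<in> V" "\<bar>u t\<bar> \<le> 1 / 2" for t
    unfolding \<eta>_def
    by (rule concentration_dichotomy(2)[OF S(3) fz(1)[OF t(1)] fz(2)[OF t(1)] \<epsilon>(2) varS[OF t(1)] t(2)])
  have zeroW: "0\<^sub>v n \<in> W0" using rs by (auto simp: W0_def)
  have addW: "t + t' \<in> W0" if "t \<in> W0" "t' \<in> W0" for t t'
    using that rs by (auto simp: W0_def chi_add)
  have u0: "\<bar>u (0\<^sub>v n)\<bar> \<ge> 1 / 2"
  proof (rule ccontr)
    assume "\<not> ?thesis"
    then have "card {a \<in> S. f (0\<^sub>v n + a) \<noteq> 0} \<le> \<eta> * card S" by (intro few_nonzeros) auto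
    moreover have "{a \<in> S. f (0\<^sub>v n + a) \<noteq> 0} = S"
      unfolding S_def cell_def A_def by auto
    ultimately show False using s \<eta> by auto
  qed
  have closed: "t + t' \<in> H" if "t \<in> H" "t' \<in> H" for t t'
  proof (rule ccontr)
    assume "t + t' \<notin> H"
    have tW: "t \<in> W0" "t' \<in> W0" and tV: "t \<in> V" "t' \<in> V" using that HW W0V by auto
    then have "\<bar>u (t + t')\<bar> \<le> 1 / 2" using \<open>t + t' \<notin> H\<close> addW by (auto simp: H_def)
    then have c1: "card {a \<in> S. f (t + t' + a) \<noteq> 0} \<le> \<eta> * card S" using tV by (intro few_nonzeros) auto
    have c2: "card {a \<in> S. f (t + a) = 0} \<le> \<eta> * card S"
      using that tV by (intro few_zeros) (auto simp: H_def)
    have c3: "card {a \<in> S. f (t' + a) = 0} \<le> \<eta> * card S"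
      using that tV by (intro few_zeros) (auto simp: H_def)
    \<comment> \<open>A point of \<open>S\<close> that \<open>t\<close> keeps in \<open>S\<close> and \<open>t + t'\<close> throws out is moved by \<open>t\<close> to a point of \<open>S\<close> that
\<open>t'\<close> throws out.\<close>
    let ?Z = "{a \<in> S. f (t + a) \<noteq> 0 \<and> f (t + t' + a) = 0}"
    have "card ?Z \<le> card {a \<in> S. f (t' + a) = 0}"
    proof (rule card_inj_on_le[where f = "\<lambda>a. t + a"])
      show "inj_on (\<lambda>a. t + a) ?Z" using tV S by (intro inj_translate) auto
      show "(\<lambda>a. t + a) ` ?Z \<subseteq> {a \<in> S. f (t' + a) = 0}"
      proof (intro image_subsetI CollectI conjI)
        fix a assume a: "a \<in> ?Z"
        then have aV: "a \<in> V" using S by auto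
        show "t + a \<in> S" using a memS[OF tW(1)] by auto
        have "t' + (t + a) = t + t' + a"
          using tV aV by (metis assoc_add_vec comm_add_vec)
        then show "f (t' + (t + a)) = 0" using a by simp
      qed
    qed (use S in auto)
    moreover have "card S \<le> card {a \<in> S. f (t + t' + a) \<noteq> 0} + card {a \<in> S. f (t + a) = 0} + card ?Z"
    proof -
      have "S = ({a \<in> S. f (t + t' + a) \<noteq> 0} \<union> {a \<in> S. f (t + a) = 0}) \<union> ?Z" by blast
      then have "card S = card (({a \<in> S. f (t + t' + a) \<noteq> 0} \<union> {a \<in> S. f (t + a) = 0}) \<union> ?Z)"
        by (rule arg_cong)
      also have "\<dots> \<le> card ({a \<in> S. f (t + t' + a) \<noteq> 0} \<union> {a \<in> S. f (t + a) = 0}) + card ?Z"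
        by (rule card_Un_le)
      also have "\<dots> \<le> card {a \<in> S. f (t + t' + a) \<noteq> 0} + card {a \<in> S. f (t + a) = 0} + card ?Z"
        by (rule add_right_mono[OF card_Un_le])
      finally show ?thesis .
    qed
    ultimately have "real (card S) \<le> 3 * (\<eta> * card S)" using c1 c2 c3 by linarith
    then show False using s \<eta> by (simp add: field_simps)
  qed
  have sub: "subspace H"
    unfolding subspace_def
  proof (intro conjI ballI)
    show "H \<subseteq> V" using HW W0V by blast
    show "0\<^sub>v n \<in> H" using zeroW u0 by (simp add: H_def)
  qed (rule closed)
  have h: "card H > 0" using sub finH by (auto simp: card_gt_0_iff subspace_def)

  have size: "card S \<le> 32 * M ^ 4 * card H"
  proof -
    \<comment> \<open>Restricting \<open>g\<close> to the cell makes the average over \<open>t + S\<close> vanish unless \<open>t\<close> preserves the sign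
pattern, so that Parseval on \<open>V\<close> only sees the translations in \<open>W0\<close>.\<close>
    define g' where "g' x = (if sign_pattern rs x = l then g x else 0)" for x
    have g': "wiener M g'" unfolding g'_def using g rs by (rule wiener_restrict_cell)
    have keyS: "sign_pattern rs a = l" if "a \<in> S" for a using that by (simp add: S_def cell_def)
    have keyt: "sign_pattern rs (t + a) = l \<longleftrightarrow> t \<in> W0" if "t \<in> V" "a \<in> S" for t a
      using sign_pattern_add[OF rs that(1), of a] that keyS S by (auto simp: W0_def)
    have u': "avg S (\<lambda>a. g' (t + a)) = (if t \<in> W0 then u t else 0)" if "t \<in> V" for t
      unfolding avg_def u_def g'_def using that by (auto simp: keyt)
    have "avg S g' = avg S (\<lambda>a. g' (0\<^sub>v n + a))"
      unfolding avg_def using S by (intro arg_cong2[where f = "(/)"] sum.cong) auto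
    then have a0: "avg S g' = u (0\<^sub>v n)" using u' zeroW by simp
    define \<delta> where "\<delta> = \<epsilon> + \<eta> * M"
    have \<delta>0: "\<delta> \<ge> 0" using \<epsilon> \<eta> M by (simp add: \<delta>_def)
    have u_small: "\<bar>u t\<bar> \<le> \<delta>" if "t \<in> W0 - H" for t
    proof -
      have tV: "t \<in> V" using that W0V by auto
      have "\<bar>\<Sum>a\<in>S. g (t + a)\<bar> \<le> (\<Sum>a\<in>S. \<bar>g (t + a)\<bar>)" by (rule sum_abs)
      also have "\<dots> \<le> (\<Sum>a\<in>S. \<epsilon> + M * of_bool (f (t + a) \<noteq> 0))"
      proof (rule sum_mono)
        fix a assume "a \<in> S"
        then have "t + a \<in> V" using S tV by auto
        then show "\<bar>g (t + a)\<bar> \<le> \<epsilon> + M * of_bool (f (t + a) \<noteq> 0)"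
          using near[of "t + a"] gM[of "t + a"] \<epsilon> by (cases "f (t + a) = 0") auto
      qed
      also have "\<dots> = \<epsilon> * card S + M * card {a \<in> S. f (t + a) \<noteq> 0}"
        using S by (simp add: sum.distrib sum_distrib_left[symmetric] Collect_conj_eq)
      also have "\<dots> \<le> \<epsilon> * card S + M * (\<eta> * card S)"
        using few_nonzeros[OF tV] that M by (intro add_left_mono mult_left_mono) (auto simp: H_def)
      finally show ?thesis using s by (simp add: u_def avg_def abs_divide field_simps \<delta>_def)
    qed
    have u_mass: "(\<Sum>t\<in>W0. \<bar>u t\<bar>) \<le> 4 * B * card S"
    proof -
      have "(\<Sum>t\<in>W0. \<bar>u t\<bar>) \<le> (\<Sum>t\<in>W0. (\<Sum>a\<in>S. \<bar>g (t + a)\<bar>) / card S)"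
        unfolding u_def avg_def abs_divide by (intro sum_mono) (simp add: divide_right_mono sum_abs)
      also have "\<dots> = (\<Sum>a\<in>S. \<Sum>t\<in>W0. \<bar>g (t + a)\<bar>) / card S"
        by (subst sum.swap) (simp add: sum_divide_distrib)
      also have "\<dots> \<le> (\<Sum>a\<in>S. \<Sum>x\<in>cell V rs l. \<bar>g x\<bar>) / card S"
      proof (intro divide_right_mono sum_mono)
        fix a assume a: "a \<in> S"
        have "(\<Sum>t\<in>W0. \<bar>g (t + a)\<bar>) = (\<Sum>t\<in>W0. \<bar>g (a + t)\<bar>)"
          using a S W0V by (intro sum.cong refl) (metis comm_add_vec subsetD)
        also have "\<dots> \<le> (\<Sum>x\<in>cell V rs l. \<bar>g x\<bar>)"
        proof (rule sum_translate_le[where F = "\<lambda>x. \<bar>g x\<bar>"])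
          fix t assume t: "t \<in> W0"
          have tV: "t \<in> V" "a \<in> V" using a t S W0V by auto
          then have "sign_pattern rs (a + t) = l" "a + t \<in> V"
            using keyt[OF tV(1) a] comm_add_vec[OF tV] t by auto
          then show "a + t \<in> cell V rs l" by (auto simp: cell_def)
        qed (use a S W0V in \<open>auto simp: cell_def\<close>)
        finally show "(\<Sum>t\<in>W0. \<bar>g (t + a)\<bar>) \<le> (\<Sum>x\<in>cell V rs l. \<bar>g x\<bar>)" .
      qed auto
      also have "\<dots> = (\<Sum>x\<in>cell V rs l. \<bar>g x\<bar>)" using s by simp
      finally show ?thesis using mass by (simp add: S_def)
    qed
    have "real (card S) * (1 / 2) ^ 4 \<le> card S * \<bar>u (0\<^sub>v n)\<bar> ^ 4"
      using u0 by (intro mult_left_mono power_mono) auto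
    also have "\<dots> \<le> M\<^sup>2 * (\<Sum>t\<in>V. (avg S (\<lambda>a. g' (t + a)))\<^sup>2)"
      using energy_lower_bound[OF g' S(1,2)] a0 by simp
    also have "(\<Sum>t\<in>V. (avg S (\<lambda>a. g' (t + a)))\<^sup>2) = (\<Sum>t\<in>V. if t \<in> W0 then (u t)\<^sup>2 else 0)"
      by (intro sum.cong) (auto simp: u')
    also have "\<dots> = (\<Sum>t\<in>W0. (u t)\<^sup>2)"
      using W0V by (simp add: sum.inter_restrict[symmetric] Int_absorb1)
    also have "\<dots> = (\<Sum>t\<in>W0 - H. (u t)\<^sup>2) + (\<Sum>t\<in>H. (u t)\<^sup>2)"
      using finH HW by (intro sum.subset_diff) auto
    also have "(\<Sum>t\<in>H. (u t)\<^sup>2) \<le> (\<Sum>t\<in>H. M\<^sup>2)"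
    proof (rule sum_mono)
      fix t assume "t \<in> H"
      then have "t \<in> V" using HW W0V by auto
      then have "\<bar>u t\<bar> \<le> M"
        unfolding u_def using S M by (intro abs_avg_le gM) auto
      then show "(u t)\<^sup>2 \<le> M\<^sup>2" using power_mono[of "\<bar>u t\<bar>" M 2] by simp
    qed
    also have "(\<Sum>t\<in>W0 - H. (u t)\<^sup>2) \<le> (\<Sum>t\<in>W0 - H. \<delta> * \<bar>u t\<bar>)"
    proof (rule sum_mono)
      fix t assume "t \<in> W0 - H"
      then have "\<bar>u t\<bar> * \<bar>u t\<bar> \<le> \<delta> * \<bar>u t\<bar>" using u_small by (intro mult_right_mono) auto
      then show "(u t)\<^sup>2 \<le> \<delta> * \<bar>u t\<bar>" by (simp add: power2_eq_square)
    qed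
    also have "\<dots> \<le> (\<Sum>t\<in>W0. \<delta> * \<bar>u t\<bar>)" using finH \<delta>0 by (intro sum_mono2) auto
    also have "\<dots> \<le> \<delta> * (4 * B * card S)"
      unfolding sum_distrib_left[symmetric] using u_mass \<delta>0 by (rule mult_left_mono)
    also have "\<delta> * (4 * B * card S) = \<delta> * (4 * B) * card S" by simp
    also have "\<dots> \<le> 1 / (32 * M\<^sup>2) * card S"
      using small by (intro mult_right_mono) (auto simp: \<delta>_def \<eta>_def)
    finally have "real (card S) * (1 / 2) ^ 4 \<le> M\<^sup>2 * (1 / (32 * M\<^sup>2) * card S + card H * M\<^sup>2)"
      using M by (simp add: mult_left_mono)
    also have "\<dots> = card S / 32 + M ^ 4 * card H"
      using M by (simp add: field_simps power2_eq_square power4_eq_xxxx)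
    finally show ?thesis by (simp add: power4_eq_xxxx)
  qed

  have "\<exists>a\<in>S. (1 - \<eta>) * card H \<le> card {t \<in> H. t + a \<in> S}"
  proof (rule ccontr)
    assume neg: "\<not> ?thesis"
    have swap: "(\<Sum>a\<in>S. real (card {t \<in> H. t + a \<in> S})) = (\<Sum>t\<in>H. real (card {a \<in> S. t + a \<in> S}))"
    proof -
      have "(\<Sum>a\<in>S. real (card {t \<in> H. t + a \<in> S})) = (\<Sum>a\<in>S. \<Sum>t\<in>H. of_bool (t + a \<in> S))"
        using finH by (simp add: Collect_conj_eq)
      also have "\<dots> = (\<Sum>t\<in>H. \<Sum>a\<in>S. of_bool (t + a \<in> S))" by (rule sum.swap)
      finally show ?thesis using S by (simp add: Collect_conj_eq)
    qed
    have "(\<Sum>t\<in>H. (1 - \<eta>) * card S) \<le> (\<Sum>t\<in>H. real (card {a \<in> S. t + a \<in> S}))"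
    proof (rule sum_mono)
      fix t assume t: "t \<in> H"
      then have tW: "t \<in> W0" "t \<in> V" using HW W0V by auto
      have "S = {a \<in> S. t + a \<in> S} \<union> {a \<in> S. f (t + a) = 0}" using memS[OF tW(1)] by blast
      then have "card S = card ({a \<in> S. t + a \<in> S} \<union> {a \<in> S. f (t + a) = 0})" by (rule arg_cong)
      then have "card S \<le> card {a \<in> S. t + a \<in> S} + card {a \<in> S. f (t + a) = 0}"
        by (simp only: card_Un_le)
      moreover have "card {a \<in> S. f (t + a) = 0} \<le> \<eta> * card S"
        using t tW by (intro few_zeros) (auto simp: H_def)
      ultimately show "(1 - \<eta>) * card S \<le> card {a \<in> S. t + a \<in> S}" by (simp add: algebra_simps)
    qed
    also have "\<dots> = (\<Sum>a\<in>S. real (card {t \<in> H. t + a \<in> S}))" by (rule swap[symmetric])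
    also have "\<dots> < (\<Sum>a\<in>S. (1 - \<eta>) * card H)"
      using neg S by (intro sum_strict_mono) auto
    finally show False by (simp add: mult_ac)
  qed
  then obtain a where a: "a \<in> S" "(1 - \<eta>) * card H \<le> card {t \<in> H. t + a \<in> S}" by blast
  define K where "K = {t \<in> H. t + a \<in> S}"
  have aV: "a \<in> V" using a S by auto
  have KH: "K \<subseteq> H" "finite K" using finH by (auto simp: K_def)
  have rest: "real (card (H - K)) \<le> \<eta> * card H"
    using a(2) card_Diff_subset[OF KH(2,1)] card_mono[OF finH(1) KH(1)]
    by (simp add: K_def of_nat_diff algebra_simps)

  have "\<exists>q. (\<Sum>h\<in>H. (g (t + h) - q)\<^sup>2) \<le> 64 * M ^ 4 * \<theta> * card H" if t: "t \<in> V" for t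
  proof
    \<comment> \<open>The coset \<open>t + H\<close> is the translate by \<open>t + a\<close> of \<open>a + H\<close>, almost all of which lies in \<open>S\<close>; the average
over the translate of \<open>S\<close> serves as centre.\<close>
    let ?q = "u (t + a)"
    have q: "\<bar>?q\<bar> \<le> M" unfolding u_def using S t aV M by (intro abs_avg_le gM) auto
    have "(\<Sum>h\<in>K. (g (t + h) - ?q)\<^sup>2) = (\<Sum>h\<in>K. (g ((t + a) + (a + h)) - ?q)\<^sup>2)"
    proof (intro sum.cong refl)
      fix h assume "h \<in> K"
      then have "h \<in> V" using KH HW W0V by auto
      then have "(t + a) + (a + h) = t + h"
        using t aV by simp
      then show "(g (t + h) - ?q)\<^sup>2 = (g ((t + a) + (a + h)) - ?q)\<^sup>2" by simp
    qed
    also have "\<dots> \<le> (\<Sum>b\<in>S. (g ((t + a) + b) - ?q)\<^sup>2)"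
    proof (rule sum_translate_le[where F = "\<lambda>b. (g ((t + a) + b) - ?q)\<^sup>2"])
      fix h assume "h \<in> K"
      then show "a + h \<in> S" using comm_add_vec[of a n h] aV HW W0V by (auto simp: K_def)
    qed (use aV KH HW W0V S in auto)
    also have "\<dots> \<le> \<theta> * card S" using var[of "t + a"] t aV by (simp add: S_def u_def)
    also have "\<dots> \<le> \<theta> * (32 * M ^ 4 * card H)" using size \<theta> by (intro mult_left_mono) auto
    finally have 1: "(\<Sum>h\<in>K. (g (t + h) - ?q)\<^sup>2) \<le> 32 * M ^ 4 * \<theta> * card H" by (simp add: mult_ac)
    have "(\<Sum>h\<in>H - K. (g (t + h) - ?q)\<^sup>2) \<le> (\<Sum>h\<in>H - K. (2 * M)\<^sup>2)"
    proof (rule sum_mono)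
      fix h assume "h \<in> H - K"
      then have "\<bar>g (t + h)\<bar> \<le> M" using t HW W0V by (intro gM) auto
      then have "\<bar>g (t + h) - ?q\<bar>\<^sup>2 \<le> (2 * M)\<^sup>2" using q by (intro power_mono) auto
      then show "(g (t + h) - ?q)\<^sup>2 \<le> (2 * M)\<^sup>2" by simp
    qed
    also have "\<dots> \<le> 4 * M\<^sup>2 * (\<eta> * card H)"
      using rest mult_right_mono[OF rest, of "4 * M\<^sup>2"] by (simp add: mult_ac)
    also have "\<dots> \<le> 4 * M ^ 4 * (\<eta> * card H)"
      using M \<eta> by (intro mult_right_mono mult_left_mono power_increasing) auto
    finally have 2: "(\<Sum>h\<in>H - K. (g (t + h) - ?q)\<^sup>2) \<le> 32 * M ^ 4 * \<theta> * card H"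
      by (simp add: \<eta>_def mult_ac)
    show "(\<Sum>h\<in>H. (g (t + h) - ?q)\<^sup>2) \<le> 64 * M ^ 4 * \<theta> * card H"
      using 1 2 sum.subset_diff[OF KH(1) finH(1), of "\<lambda>h. (g (t + h) - ?q)\<^sup>2"] by simp
  qed
  moreover have "card H / 2 \<le> card {h \<in> H. f (a + h) \<noteq> 0}"
  proof -
    have "K \<subseteq> {h \<in> H. f (a + h) \<noteq> 0}"
    proof
      fix h assume h: "h \<in> K"
      then have "f (h + a) \<noteq> 0" using memS[of h a] a HW by (auto simp: K_def)
      moreover have "h + a = a + h" using h aV KH HW W0V by (intro comm_add_vec) auto
      ultimately show "h \<in> {h \<in> H. f (a + h) \<noteq> 0}" using h by (auto simp: K_def)
    qed
    then have "card K \<le> card {h \<in> H. f (a + h) \<noteq> 0}" using finH by (intro card_mono) auto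
    moreover have "1 / 2 * card H \<le> (1 - \<eta>) * card H" using \<eta> by (intro mult_right_mono) auto
    ultimately show ?thesis using a(2) by (simp add: K_def)
  qed
  ultimately show ?thesis
    using sub size aV unfolding S_def by (intro exI[of _ H] conjI ballI bexI[of _ a]) blast+
qed

text \<open>The pinned cell has small variance on all its translates, so its stabiliser can be used.  The conclusions are those needed
for one round: an integer lies near each coset average because \<open>g\<close> is close to its average at some point of
the coset and \<open>f\<close> is an integer there.  The value of \<open>\<gamma>\<close> makes the covariance bound of the pinned cell equal to
\<open>\<theta>\<^sup>2 / M\<^sup>2\<close>, the one that yields variance \<open>\<theta>\<close>.\<close>

lemma exists_concentrating_subspace:
  fixes f g c :: "bit vec \<Rightarrow> real" and M B \<epsilon> \<theta> :: real
  defines "A \<equiv> {x \<in> V. f x \<noteq> 0}"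
  assumes f: "\<And>x. x \<in> V \<Longrightarrow> f x \<in> \<int>" and A: "A \<noteq> {}"
    and g: "\<And>x. x \<in> V \<Longrightarrow> g x = (\<Sum>r\<in>V. c r * chi r x)" and c: "(\<Sum>r\<in>V. \<bar>c r\<bar>) \<le> M"
    and near: "\<And>x. x \<in> V \<Longrightarrow> \<bar>f x - g x\<bar> \<le> \<epsilon>" and \<epsilon>: "0 \<le> \<epsilon>" "\<epsilon> \<le> 1 / 8"
    and mass: "(\<Sum>x\<in>V. \<bar>g x\<bar>) \<le> B * card A" and M: "M \<ge> 1" and B: "B > 0"
    and \<theta>: "0 < \<theta>" "\<theta> \<le> 1 / (2048 * M ^ 4)"
    and small: "(\<epsilon> + 8 * \<theta> * M) * (4 * B) \<le> 1 / (32 * M\<^sup>2)"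
  obtains H where "subspace H" "card A \<le> 128 * M ^ 4 * 2 powr (4 * M ^ 4 / \<theta>\<^sup>2) * card H"
    "\<And>t. t \<in> V \<Longrightarrow> \<exists>z\<in>\<int>. \<bar>avg H (\<lambda>h. g (t + h)) - z\<bar> \<le> \<epsilon> + 8 * M\<^sup>2 * sqrt \<theta>"
    "\<And>t. t \<in> V \<Longrightarrow> \<bar>avg H (\<lambda>h. g (t + h))\<bar> \<ge> 1 / 2 \<Longrightarrow> card H / 2 \<le> card {h \<in> H. f (t + h) \<noteq> 0}"
    "\<exists>t\<in>V. \<bar>avg H (\<lambda>h. g (t + h))\<bar> \<ge> 1 / 2"
proof -
  define \<gamma> where "\<gamma> = \<theta>\<^sup>2 / (4 * M ^ 3)"
  have \<gamma>: "\<gamma> > 0" "4 * M * \<gamma> = \<theta>\<^sup>2 / M\<^sup>2"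
    using \<theta> M by (auto simp: \<gamma>_def field_simps power2_eq_square power3_eq_cube)
  have AV: "A \<subseteq> V" by (auto simp: A_def)
  have M0: "M > 0" using M by simp
  have g_wiener: "wiener M g" unfolding wiener_def using g c by blast
  obtain rs l where rs: "set rs \<subseteq> V" "length rs * \<gamma> \<le> M" "cell A rs l \<noteq> {}"
    and cA: "card A \<le> 4 * 2 ^ length rs * real (card (cell A rs l))"
    and gW: "(\<Sum>x\<in>cell V rs l. \<bar>g x\<bar>) \<le> 4 * B * card (cell A rs l)"
    and X: "(\<Sum>r\<in>V. \<Sum>s\<in>V. \<bar>c r\<bar> * \<bar>c s\<bar> * (cov (cell A rs l) r s)\<^sup>2) \<le> 4 * M * \<gamma>"
    using exists_pinned_cell[OF AV A c \<gamma>(1) M0 B mass] by blast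
  have S: "cell A rs l \<subseteq> V" using AV cell_subset by blast
  have var: "(\<Sum>a\<in>cell A rs l. (g (t + a) - avg (cell A rs l) (\<lambda>a. g (t + a)))\<^sup>2) \<le> \<theta> * card (cell A rs l)"
    if "t \<in> V" for t
    using variance_of_translates[OF g c M0 \<theta>(1) S rs(3) _ that] X \<gamma>(2) by simp
  have M4: "M ^ 4 \<ge> 1" using M by simp
  have "\<theta> \<le> 1 / 2048"
    using \<theta>(2) frac_le[of 1 1 2048 "2048 * M ^ 4"] M4 by simp
  then have "\<theta> \<le> 1 / 128" by simp
  then obtain H a where H: "subspace H"
    and size: "card (cell A rs l) \<le> 32 * M ^ 4 * card H"
    and varH: "\<And>t. t \<in> V \<Longrightarrow> \<exists>q. (\<Sum>h\<in>H. (g (t + h) - q)\<^sup>2) \<le> 64 * M ^ 4 * \<theta> * card H"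
    and a: "a \<in> V" "card H / 2 \<le> card {h \<in> H. f (a + h) \<noteq> 0}"
    using stabiliser_of_pinned_cell[OF f g_wiener M near \<epsilon> rs(1) rs(3)[unfolded A_def]
        var[unfolded A_def] gW[unfolded A_def] B \<theta>(1) _ small] unfolding A_def by blast
  define m where "m t = avg H (\<lambda>h. g (t + h))" for t
  define \<tau> where "\<tau> = 64 * M ^ 4 * \<theta>"
  have \<tau>: "\<tau> > 0" "\<tau> \<le> 1 / 32" using M M0 \<theta> by (auto simp: \<tau>_def field_simps)
  have sqrt_\<tau>: "sqrt \<tau> = 8 * M\<^sup>2 * sqrt \<theta>"
  proof -
    have "64 * M ^ 4 = (8 * M\<^sup>2)\<^sup>2" by (simp add: power_mult_distrib)
    then show ?thesis unfolding \<tau>_def by (simp only: real_sqrt_mult real_sqrt_abs) simp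
  qed
  have HV: "H \<subseteq> V" "H \<noteq> {}" using H by (auto simp: subspace_def)
  have finH: "finite H" using HV(1) finite_V by (rule finite_subset)
  have h: "card H > 0" using HV finH by (simp add: card_gt_0_iff)
  have var_m: "(\<Sum>h\<in>H. (g (t + h) - m t)\<^sup>2) \<le> \<tau> * card H" if t: "t \<in> V" for t
  proof -
    obtain q where "(\<Sum>h\<in>H. (g (t + h) - q)\<^sup>2) \<le> \<tau> * card H" using varH[OF t] unfolding \<tau>_def by blast
    then show ?thesis
      using avg_minimises_variance[OF finH, of "\<lambda>h. g (t + h)" q] unfolding m_def by linarith
  qed
  have fz: "f (t + h) \<in> \<int>" "\<bar>f (t + h) - g (t + h)\<bar> \<le> \<epsilon>" if "t \<in> V" "h \<in> H" for t h
    using that HV f near by auto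
  have P1: "\<exists>z\<in>\<int>. \<bar>m t - z\<bar> \<le> \<epsilon> + 8 * M\<^sup>2 * sqrt \<theta>" if t: "t \<in> V" for t
  proof -
    have "\<exists>h\<in>H. (g (t + h) - m t)\<^sup>2 \<le> \<tau>"
    proof (rule ccontr)
      assume "\<not> ?thesis"
      then have "(\<Sum>h\<in>H. \<tau>) < (\<Sum>h\<in>H. (g (t + h) - m t)\<^sup>2)"
        using finH HV by (intro sum_strict_mono) auto
      then show False using var_m[OF t] by (simp add: mult_ac)
    qed
    then obtain h where hh: "h \<in> H" "(g (t + h) - m t)\<^sup>2 \<le> \<tau>" by blast
    have "\<bar>g (t + h) - m t\<bar> \<le> sqrt \<tau>" using hh(2) real_sqrt_le_mono[OF hh(2)] by simp
    then have "\<bar>m t - f (t + h)\<bar> \<le> \<epsilon> + 8 * M\<^sup>2 * sqrt \<theta>"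
      using fz(2)[OF t hh(1)] sqrt_\<tau> by linarith
    then show ?thesis using fz(1)[OF t hh(1)] by blast
  qed
  have split: "card H = card {h \<in> H. f (t + h) = 0} + card {h \<in> H. f (t + h) \<noteq> 0}" for t
  proof -
    have "H = {h \<in> H. f (t + h) = 0} \<union> {h \<in> H. f (t + h) \<noteq> 0}" by auto
    then have "card H = card ({h \<in> H. f (t + h) = 0} \<union> {h \<in> H. f (t + h) \<noteq> 0})" by (rule arg_cong)
    also have "\<dots> = card {h \<in> H. f (t + h) = 0} + card {h \<in> H. f (t + h) \<noteq> 0}"
      using finH by (intro card_Un_disjoint) auto
    finally show ?thesis .
  qed
  have P2: "card H / 2 \<le> card {h \<in> H. f (t + h) \<noteq> 0}" if t: "t \<in> V" and m: "\<bar>m t\<bar> \<ge> 1 / 2" for t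
  proof -
    have "card {h \<in> H. f (t + h) = 0} \<le> 8 * \<tau> * card H"
      by (rule concentration_dichotomy(1)[OF finH fz(1)[OF t] fz(2)[OF t] \<epsilon>(2) var_m[OF t] m]) auto
    also have "\<dots> \<le> 1 / 2 * card H" using \<tau> by (intro mult_right_mono) auto
    finally show ?thesis using split[of t] by linarith
  qed
  have P3: "\<bar>m a\<bar> \<ge> 1 / 2"
  proof (rule ccontr)
    assume "\<not> ?thesis"
    then have m: "\<bar>m a\<bar> \<le> 1 / 2" by simp
    have "card {h \<in> H. f (a + h) \<noteq> 0} \<le> 8 * \<tau> * card H"
      by (rule concentration_dichotomy(2)[OF finH fz(1)[OF a(1)] fz(2)[OF a(1)] \<epsilon>(2) var_m[OF a(1)] m]) auto
    also have "\<dots> \<le> 1 / 4 * card H" using \<tau> by (intro mult_right_mono) auto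
    finally show False using a(2) h by simp
  qed
  have "card A \<le> 128 * M ^ 4 * 2 powr (4 * M ^ 4 / \<theta>\<^sup>2) * card H"
  proof -
    have "length rs \<le> M / \<gamma>" using rs(2) \<gamma>(1) by (simp add: field_simps)
    also have "M / \<gamma> = 4 * M ^ 4 / \<theta>\<^sup>2"
      using M0 \<theta> by (simp add: \<gamma>_def field_simps power3_eq_cube power4_eq_xxxx)
    finally have len: "2 ^ length rs \<le> 2 powr (4 * M ^ 4 / \<theta>\<^sup>2)"
      by (simp add: powr_realpow[symmetric])
    have "card A \<le> 4 * 2 ^ length rs * (32 * M ^ 4 * card H)"
      by (rule order_trans[OF cA mult_left_mono[OF size]]) simp
    also have "\<dots> = 128 * M ^ 4 * card H * 2 ^ length rs" by simp
    also have "\<dots> \<le> 128 * M ^ 4 * card H * 2 powr (4 * M ^ 4 / \<theta>\<^sup>2)"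
      using len M0 by (intro mult_left_mono) auto
    finally show ?thesis by (simp add: mult_ac)
  qed
  then show ?thesis
    using that[of H] H P1 P2 P3 a(1) unfolding m_def by blast
qed

section \<open>Signed sums of indicators of subspaces\<close>

text \<open>The bound \<open>L\<close> on the number of terms is a real number, so that bounds can be added and compared without
rounding.\<close>

definition signed_sum :: "real \<Rightarrow> (bit vec \<Rightarrow> real) \<Rightarrow> bool" where
  "signed_sum L F \<longleftrightarrow> (\<exists>ps :: (real \<times> bit vec set) list. real (length ps) \<le> L \<and>
    (\<forall>p\<in>set ps. fst p \<in> {1, -1} \<and> subspace (snd p)) \<and>
    (\<forall>x\<in>V. F x = (\<Sum>p\<leftarrow>ps. fst p * indicator (snd p) x)))"

lemma signed_sum_zero: "0 \<le> L \<Longrightarrow> (\<And>x. x \<in> V \<Longrightarrow> F x = 0) \<Longrightarrow> signed_sum L F"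
  unfolding signed_sum_def by (intro exI[of _ "[]"]) auto

lemma signed_sum_cong: "signed_sum L F \<Longrightarrow> (\<And>x. x \<in> V \<Longrightarrow> F x = G x) \<Longrightarrow> signed_sum L G"
  unfolding signed_sum_def by auto

lemma signed_sum_mono: "signed_sum L F \<Longrightarrow> L \<le> L' \<Longrightarrow> signed_sum L' F"
  unfolding signed_sum_def by (elim exE, rule exI) (auto elim: order_trans)

lemma signed_sum_add:
  assumes "signed_sum L F" "signed_sum K G"
  shows "signed_sum (L + K) (\<lambda>x. F x + G x)"
proof -
  from assms obtain ps qs where
    "length ps \<le> L" "\<forall>p\<in>set ps. fst p \<in> {1, -1} \<and> subspace (snd p)"
    "\<forall>x\<in>V. F x = (\<Sum>p\<leftarrow>ps. fst p * indicator (snd p) x)"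
    "length qs \<le> K" "\<forall>p\<in>set qs. fst p \<in> {1, -1} \<and> subspace (snd p)"
    "\<forall>x\<in>V. G x = (\<Sum>p\<leftarrow>qs. fst p * indicator (snd p) x)"
    unfolding signed_sum_def by blast
  then show ?thesis unfolding signed_sum_def by (intro exI[of _ "ps @ qs"]) auto
qed

lemma signed_sum_minus:
  assumes "signed_sum L F" shows "signed_sum L (\<lambda>x. - F x)"
proof -
  from assms obtain ps where ps:
    "length ps \<le> L" "\<forall>p\<in>set ps. fst p \<in> {1, -1} \<and> subspace (snd p)"
    "\<forall>x\<in>V. F x = (\<Sum>p\<leftarrow>ps. fst p * indicator (snd p) x)"
    unfolding signed_sum_def by blast
  define qs where "qs = map (apfst uminus) ps"
  have "(\<Sum>p\<leftarrow>qs. fst p * indicator (snd p) x) = - (\<Sum>p\<leftarrow>ps. fst p * indicator (snd p) x)"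
    for x :: "bit vec"
    unfolding qs_def by (induction ps) auto
  moreover have "\<forall>p\<in>set qs. fst p \<in> {1, -1} \<and> subspace (snd p)"
    using ps(2) by (auto simp: qs_def)
  moreover have "length qs \<le> L" using ps(1) by (simp add: qs_def)
  ultimately show ?thesis unfolding signed_sum_def using ps(3) by (intro exI[of _ qs]) simp
qed

lemma signed_sum_int_mult:
  assumes F: "signed_sum L F" and k: "k \<in> \<int>"
  shows "signed_sum (\<bar>k\<bar> * L) (\<lambda>x. k * F x)"
proof -
  have nat: "signed_sum (real j * L) (\<lambda>x. real j * F x)" for j
  proof (induction j)
    case (Suc j)
    show ?case using signed_sum_add[OF Suc F] by (simp add: algebra_simps)
  qed (simp add: signed_sum_zero)
  obtain i where i: "k = of_int i" using k by (rule Ints_cases)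
  show ?thesis
  proof (cases "i \<ge> 0")
    case True
    then have "real (nat i) = k" "\<bar>k\<bar> = k" by (auto simp: i)
    then show ?thesis using nat[of "nat i"] by simp
  next
    case False
    then have "real (nat (- i)) = - k" "\<bar>k\<bar> = - k" by (auto simp: i)
    then show ?thesis using signed_sum_minus[OF nat[of "nat (- i)"]] by simp
  qed
qed

lemma subspace_add_iff:
  assumes "subspace H" "h \<in> H" "x \<in> V" shows "h + x \<in> H \<longleftrightarrow> x \<in> H"
  using assms unfolding subspace_def by (metis add_add_self subsetD)

lemma add_left_comm: "x \<in> V \<Longrightarrow> y \<in> V \<Longrightarrow> z \<in> V \<Longrightarrow> x + (y + z) = y + (x + z)"
  for x :: "bit vec"
  using assoc_add_vec[of x n y z] assoc_add_vec[of y n x z] comm_add_vec[of x n y] by simp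

text \<open>If \<open>t\<close> is not in \<open>H\<close>, then \<open>H\<close> together with its coset \<open>t + H\<close> is a subspace \<open>K\<close>, and the indicator of the
coset is the difference of those of \<open>K\<close> and \<open>H\<close>.\<close>

lemma signed_sum_coset:
  assumes H: "subspace H" and t: "t \<in> V"
  shows "signed_sum 2 (\<lambda>x. indicator H (t + x))"
proof (cases "t \<in> H")
  case True
  then show ?thesis unfolding signed_sum_def
    using H by (intro exI[of _ "[(1, H)]"]) (auto simp: indicator_def subspace_add_iff)
next
  case False
  define K where "K = H \<union> {x \<in> V. t + x \<in> H}"
  have HV: "H \<subseteq> V" using H by (simp add: subspace_def)
  have "subspace K"
    unfolding subspace_def
  proof (intro conjI ballI)
    show "K \<subseteq> V" "0\<^sub>v n \<in> K" using H by (auto simp: K_def subspace_def)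
    fix x y assume xy: "x \<in> K" "y \<in> K"
    then have V: "x \<in> V" "y \<in> V" using HV by (auto simp: K_def)
    have cl: "u + v \<in> H" if "u \<in> H" "v \<in> H" for u v using H that by (simp add: subspace_def)
    have e1: "t + (x + y) = (t + x) + y" using V t by simp
    have e2: "t + (x + y) = x + (t + y)" using V t by (simp add: add_left_comm)
    have e3: "x + y = (t + x) + (t + y)" using V t by (simp add: add_left_comm)
    have xyV: "x + y \<in> V" using V by simp
    consider "x \<in> H" "y \<in> H" | "x \<in> H" "t + y \<in> H" | "t + x \<in> H" "y \<in> H" | "t + x \<in> H" "t + y \<in> H"
      using xy by (auto simp: K_def)
    then have "x + y \<in> H \<or> t + (x + y) \<in> H"
      by cases (use cl e1 e2 e3 in metis)+
    then show "x + y \<in> K" using xyV by (auto simp: K_def)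
  qed
  moreover have "indicator H (t + x) = (indicator K x - indicator H x :: real)" if x: "x \<in> V" for x
  proof -
    have "\<not> (x \<in> H \<and> t + x \<in> H)"
      using False subspace_add_iff[OF H, of x t] x t comm_add_vec[of x n t] by auto
    then show ?thesis using x by (auto simp: K_def indicator_def)
  qed
  ultimately show ?thesis unfolding signed_sum_def
    using H by (intro exI[of _ "[(1, K), (-1, H)]"]) auto
qed

text \<open>The support of \<open>Z\<close> is a union of cosets of \<open>H\<close>; they are removed one by one.\<close>

lemma signed_sum_invariant:
  fixes b :: real
  assumes H: "subspace H"
  shows "(\<And>x. x \<in> V \<Longrightarrow> Z x \<in> \<int>) \<Longrightarrow> (\<And>x. x \<in> V \<Longrightarrow> \<bar>Z x\<bar> \<le> b) \<Longrightarrow>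
    (\<And>x h. x \<in> V \<Longrightarrow> h \<in> H \<Longrightarrow> Z (h + x) = Z x) \<Longrightarrow>
    signed_sum (2 * b * card {x \<in> V. Z x \<noteq> 0} / card H) Z"
proof (induction "card {x \<in> V. Z x \<noteq> 0}" arbitrary: Z rule: less_induct)
  case less
  have HV: "H \<subseteq> V" "H \<noteq> {}" using H by (auto simp: subspace_def)
  have finH: "finite H" using HV(1) finite_V by (rule finite_subset)
  have h: "card H > 0" using HV finH by (simp add: card_gt_0_iff)
  have "\<bar>Z (0\<^sub>v n)\<bar> \<le> b" by (rule less.prems(2)) simp
  then have b: "b \<ge> 0" by linarith
  show ?case
  proof (cases "{x \<in> V. Z x \<noteq> 0} = {}")
    case True
    then show ?thesis using b by (intro signed_sum_zero) auto
  next
    case False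
    then obtain t where t: "t \<in> V" "Z t \<noteq> 0" by blast
    define Z' where "Z' x = Z x - Z t * indicator H (t + x)" for x
    define C where "C = {x \<in> V. t + x \<in> H}"
    have ZC: "Z x = Z t" if "x \<in> C" for x
    proof -
      have "Z ((t + x) + t) = Z t" using that t by (intro less.prems(3)) (auto simp: C_def)
      moreover have "(t + x) + t = x" using that t comm_add_vec[of "t + x" n t] by (simp add: C_def)
      ultimately show ?thesis by simp
    qed
    have C_im: "C = (\<lambda>h. t + h) ` H"
    proof
      show "C \<subseteq> (\<lambda>h. t + h) ` H"
      proof
        fix x assume "x \<in> C"
        then have "x = t + (t + x)" "t + x \<in> H" using t by (auto simp: C_def)
        then show "x \<in> (\<lambda>h. t + h) ` H" by (rule image_eqI)
      qed
    qed (use t HV in \<open>auto simp: C_def\<close>)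
    have cC: "card C = card H" unfolding C_im using t HV by (intro card_image inj_translate) auto
    have Z'x: "Z' x = (if x \<in> C then 0 else Z x)" if "x \<in> V" for x
    proof (cases "x \<in> C")
      case True
      then have "indicator H (t + x) = (1 :: real)" by (simp add: C_def)
      then show ?thesis using True by (simp add: Z'_def ZC)
    next
      case False
      then have "indicator H (t + x) = (0 :: real)" using that by (simp add: C_def)
      then show ?thesis using False by (simp add: Z'_def)
    qed
    have supp: "{x \<in> V. Z' x \<noteq> 0} = {x \<in> V. Z x \<noteq> 0} - C"
    proof (rule Set.set_eqI)
      fix x
      show "x \<in> {x \<in> V. Z' x \<noteq> 0} \<longleftrightarrow> x \<in> {x \<in> V. Z x \<noteq> 0} - C"
        by (cases "x \<in> V"; cases "x \<in> C") (simp_all add: Z'x)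
    qed
    have Csub: "C \<subseteq> {x \<in> V. Z x \<noteq> 0}"
    proof
      fix x assume x: "x \<in> C"
      show "x \<in> {x \<in> V. Z x \<noteq> 0}" using ZC[OF x] x t(2) by (simp add: C_def)
    qed
    have fin: "finite C" by (simp add: C_def)
    have card_eq: "card {x \<in> V. Z x \<noteq> 0} = card {x \<in> V. Z' x \<noteq> 0} + card H"
      unfolding supp using card_Diff_subset[OF fin Csub] card_mono[OF _ Csub] cC by auto
    have "signed_sum (2 * b * card {x \<in> V. Z' x \<noteq> 0} / card H) Z'"
    proof (rule less.hyps)
      show "card {x \<in> V. Z' x \<noteq> 0} < card {x \<in> V. Z x \<noteq> 0}" using card_eq h by simp
      fix x assume x: "x \<in> V"
      show "Z' x \<in> \<int>" using less.prems(1)[OF x] by (simp add: Z'x[OF x])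
      show "\<bar>Z' x\<bar> \<le> b" using less.prems(2)[OF x] b by (simp add: Z'x[OF x])
      fix k assume k: "k \<in> H"
      have "t + (k + x) = k + (t + x)" using k HV x t by (intro add_left_comm) auto
      then have "t + (k + x) \<in> H \<longleftrightarrow> t + x \<in> H" using subspace_add_iff[OF H k, of "t + x"] x t by auto
      then show "Z' (k + x) = Z' x" using less.prems(3)[OF x k] by (simp add: Z'_def indicator_def)
    qed
    moreover have "signed_sum (\<bar>Z t\<bar> * 2) (\<lambda>x. Z t * indicator H (t + x))"
      using t by (intro signed_sum_int_mult signed_sum_coset H less.prems)
    ultimately have "signed_sum (2 * b * card {x \<in> V. Z' x \<noteq> 0} / card H + \<bar>Z t\<bar> * 2)
        (\<lambda>x. Z' x + Z t * indicator H (t + x))" by (rule signed_sum_add)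
    moreover have "2 * b * card {x \<in> V. Z' x \<noteq> 0} / card H + \<bar>Z t\<bar> * 2
        \<le> 2 * b * card {x \<in> V. Z x \<noteq> 0} / card H"
      using less.prems(2)[OF t(1)] h unfolding card_eq by (simp add: field_simps)
    ultimately have "signed_sum (2 * b * card {x \<in> V. Z x \<noteq> 0} / card H)
        (\<lambda>x. Z' x + Z t * indicator H (t + x))" by (rule signed_sum_mono)
    then show ?thesis by (rule signed_sum_cong) (simp add: Z'_def)
  qed
qed

section \<open>Splitting off coset averages\<close>

text \<open>Unless \<open>chi r\<close> is trivial on \<open>H\<close>, translation by some \<open>k \<in> H\<close> reverses the sign of its sum over \<open>H\<close>.\<close>

lemma avg_subspace_chi:
  assumes H: "subspace H" and r: "r \<in> V"
  shows "avg H (chi r) = 0 \<or> avg H (chi r) = 1"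
proof (cases "\<forall>h\<in>H. chi r h = 1")
  case True
  have HV: "H \<subseteq> V" "H \<noteq> {}" using H by (auto simp: subspace_def)
  have finH: "finite H" using HV(1) finite_V by (rule finite_subset)
  have "(\<Sum>h\<in>H. chi r h) = card H" using True by simp
  then show ?thesis using HV finH by (simp add: avg_def)
next
  case False
  then obtain k where k: "k \<in> H" "chi r k = -1" using chi_cases by blast
  have HV: "H \<subseteq> V" using H by (simp add: subspace_def)
  have kV: "k \<in> V" using k HV by blast
  have "(\<Sum>h\<in>H. chi r h) = (\<Sum>h\<in>H. chi r (k + h))"
    by (rule sum.reindex_bij_witness[where i = "\<lambda>h. k + h" and j = "\<lambda>h. k + h"])
      (use H HV k kV in \<open>auto simp: subspace_def subset_iff\<close>)
  also have "\<dots> = (\<Sum>h\<in>H. - chi r h)"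
    using HV kV r k by (intro sum.cong) (auto simp: chi_add)
  finally show ?thesis by (simp add: avg_def sum_negf)
qed

lemma avg_expand:
  fixes g c :: "bit vec \<Rightarrow> real"
  assumes g: "\<And>x. x \<in> V \<Longrightarrow> g x = (\<Sum>r\<in>V. c r * chi r x)" and H: "H \<subseteq> V" and t: "t \<in> V"
  shows "avg H (\<lambda>h. g (t + h)) = (\<Sum>r\<in>V. (c r * avg H (chi r)) * chi r t)"
proof -
  have "(\<Sum>h\<in>H. g (t + h)) = (\<Sum>h\<in>H. \<Sum>r\<in>V. c r * chi r t * chi r h)"
    using H t by (intro sum.cong refl) (auto simp: g chi_add mult_ac intro!: sum.cong)
  also have "\<dots> = (\<Sum>r\<in>V. c r * chi r t * (\<Sum>h\<in>H. chi r h))"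
    by (subst sum.swap) (simp add: sum_distrib_left)
  finally show ?thesis unfolding avg_def by (simp add: sum_divide_distrib[of _ V] mult_ac)
qed

lemma avg_translate_invariant:
  assumes H: "subspace H" and k: "k \<in> H" and x: "x \<in> V"
  shows "avg H (\<lambda>h. F ((k + x) + h)) = avg H (\<lambda>h. F (x + h))"
proof -
  have HV: "H \<subseteq> V" using H by (simp add: subspace_def)
  have kV: "k \<in> V" using k HV by blast
  have "(\<Sum>h\<in>H. F ((k + x) + h)) = (\<Sum>h\<in>H. F (x + h))"
  proof (rule sum.reindex_bij_witness[where i = "\<lambda>h. k + h" and j = "\<lambda>h. k + h"])
    fix h assume h: "h \<in> H"
    then have hV: "h \<in> V" using HV by blast
    show "k + (k + h) = h" using kV hV by simp
    then show "k + (k + h) = h" .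
    show "k + h \<in> H" using H h k by (simp add: subspace_def)
    then show "k + h \<in> H" .
    have "x + (k + h) = (k + x) + h" using kV hV x add_left_comm[of x k h] by simp
    then show "F (x + (k + h)) = F ((k + x) + h)" by simp
  qed
  then show ?thesis by (simp add: avg_def)
qed

lemma kernel_L1_bound:
  fixes f g K :: "bit vec \<Rightarrow> real"
  assumes g: "\<And>x. x \<in> V \<Longrightarrow> g x = (\<Sum>y\<in>V. K y * f (x + y))" and K: "(\<Sum>y\<in>V. \<bar>K y\<bar>) \<le> \<kappa>"
  shows "(\<Sum>x\<in>V. \<bar>g x\<bar>) \<le> \<kappa> * (\<Sum>x\<in>V. \<bar>f x\<bar>)"
proof -
  have "(\<Sum>x\<in>V. \<bar>g x\<bar>) \<le> (\<Sum>x\<in>V. \<Sum>y\<in>V. \<bar>K y\<bar> * \<bar>f (x + y)\<bar>)"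
    by (intro sum_mono) (simp add: g abs_mult[symmetric] sum_abs)
  also have "\<dots> = (\<Sum>y\<in>V. \<bar>K y\<bar> * (\<Sum>x\<in>V. \<bar>f (x + y)\<bar>))"
    by (subst sum.swap) (simp add: sum_distrib_left)
  also have "\<dots> = (\<Sum>y\<in>V. \<bar>K y\<bar> * (\<Sum>x\<in>V. \<bar>f x\<bar>))"
  proof (intro sum.cong refl)
    fix y assume y: "y \<in> V"
    have "(\<Sum>x\<in>V. \<bar>f (x + y)\<bar>) = (\<Sum>x\<in>V. \<bar>f (y + x)\<bar>)"
    proof (intro sum.cong refl)
      fix x assume "x \<in> V"
      then show "\<bar>f (x + y)\<bar> = \<bar>f (y + x)\<bar>" using comm_add_vec[of x n y] y by simp
    qed
    then show "\<bar>K y\<bar> * (\<Sum>x\<in>V. \<bar>f (x + y)\<bar>) = \<bar>K y\<bar> * (\<Sum>x\<in>V. \<bar>f x\<bar>)"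
      using sum_translate[OF y, of "\<lambda>x. \<bar>f x\<bar>"] by simp
  qed
  also have "\<dots> \<le> \<kappa> * (\<Sum>x\<in>V. \<bar>f x\<bar>)"
    unfolding sum_distrib_right[symmetric] using K by (intro mult_right_mono) (auto intro: sum_nonneg)
  finally show ?thesis .
qed

text \<open>Subtracting coset averages from a convolution amounts to subtracting coset averages from its kernel.\<close>

lemma split_kernel:
  fixes K :: "bit vec \<Rightarrow> real"
  assumes H: "subspace H"
  defines "K' \<equiv> \<lambda>y. K y - avg H (\<lambda>h. K (h + y))"
  defines "T \<equiv> \<lambda>F x. \<Sum>y\<in>V. K y * F (x + y)"
  shows "(\<Sum>y\<in>V. \<bar>K' y\<bar>) \<le> 2 * (\<Sum>y\<in>V. \<bar>K y\<bar>)"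
    and "x \<in> V \<Longrightarrow> (\<Sum>y\<in>V. K' y * F (x + y)) = T F x - avg H (\<lambda>h. T F (x + h))"
proof -
  have HV: "H \<subseteq> V" "H \<noteq> {}" using H by (auto simp: subspace_def)
  have finH: "finite H" using HV(1) finite_V by (rule finite_subset)
  have h: "card H > 0" using HV finH by (simp add: card_gt_0_iff)
  have swap: "(\<Sum>y\<in>V. avg H (\<lambda>h. G h y)) = avg H (\<lambda>h. \<Sum>y\<in>V. G h y)" for G :: "bit vec \<Rightarrow> bit vec \<Rightarrow> real"
    unfolding avg_def by (simp add: sum_divide_distrib[symmetric] sum.swap[of _ V])
  have "(\<Sum>y\<in>V. \<bar>K' y\<bar>) \<le> (\<Sum>y\<in>V. \<bar>K y\<bar> + avg H (\<lambda>h. \<bar>K (h + y)\<bar>))"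
  proof (rule sum_mono)
    fix y
    have "\<bar>avg H (\<lambda>h. K (h + y))\<bar> \<le> avg H (\<lambda>h. \<bar>K (h + y)\<bar>)"
      unfolding avg_def abs_divide by (simp add: divide_right_mono sum_abs)
    then show "\<bar>K' y\<bar> \<le> \<bar>K y\<bar> + avg H (\<lambda>h. \<bar>K (h + y)\<bar>)" unfolding K'_def by linarith
  qed
  also have "\<dots> = (\<Sum>y\<in>V. \<bar>K y\<bar>) + avg H (\<lambda>h. \<Sum>y\<in>V. \<bar>K (h + y)\<bar>)"
    by (simp add: sum.distrib swap)
  also have "avg H (\<lambda>h. \<Sum>y\<in>V. \<bar>K (h + y)\<bar>) = avg H (\<lambda>h. \<Sum>y\<in>V. \<bar>K y\<bar>)"
    unfolding avg_def using HV
    by (intro arg_cong2[where f = "(/)"] sum.cong refl sum_translate[where F = "\<lambda>y. \<bar>K y\<bar>"]) auto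
  also have "\<dots> = (\<Sum>y\<in>V. \<bar>K y\<bar>)" using h by (simp add: avg_def)
  finally show "(\<Sum>y\<in>V. \<bar>K' y\<bar>) \<le> 2 * (\<Sum>y\<in>V. \<bar>K y\<bar>)" by simp
  show "(\<Sum>y\<in>V. K' y * F (x + y)) = T F x - avg H (\<lambda>h. T F (x + h))" if x: "x \<in> V"
  proof -
    have "(\<Sum>y\<in>V. K' y * F (x + y)) = T F x - (\<Sum>y\<in>V. avg H (\<lambda>h. K (h + y)) * F (x + y))"
      unfolding K'_def T_def by (simp add: left_diff_distrib sum_subtractf)
    also have "(\<Sum>y\<in>V. avg H (\<lambda>h. K (h + y)) * F (x + y)) = (\<Sum>y\<in>V. avg H (\<lambda>h. K (h + y) * F (x + y)))"
      by (simp add: avg_def sum_distrib_right)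
    also have "\<dots> = avg H (\<lambda>h. \<Sum>y\<in>V. K (h + y) * F (x + y))" by (rule swap)
    also have "\<dots> = avg H (\<lambda>h. T F (x + h))"
      unfolding avg_def
    proof (intro arg_cong2[where f = "(/)"] sum.cong refl)
      fix h assume "h \<in> H"
      then have hV: "h \<in> V" using HV by blast
      have "(\<Sum>y\<in>V. K (h + y) * F (x + y)) = (\<Sum>y\<in>V. K (h + (h + y)) * F (x + (h + y)))"
        by (rule sum_translate[OF hV, symmetric])
      also have "\<dots> = T F (x + h)"
        unfolding T_def using hV x by (intro sum.cong) auto
      finally show "(\<Sum>y\<in>V. K (h + y) * F (x + y)) = T F (x + h)" .
    qed
    finally show ?thesis .
  qed
qed

text \<open>Double counting of the pairs \<open>t \<in> D\<close>, \<open>h \<in> H\<close> with \<open>f (t + h) \<noteq> 0\<close>.\<close>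

lemma heavy_support:
  assumes H: "H \<subseteq> V" "H \<noteq> {}" and D: "D \<subseteq> V"
    and heavy: "\<And>t. t \<in> D \<Longrightarrow> card H / 2 \<le> card {h \<in> H. f (t + h) \<noteq> (0 :: real)}"
  shows "card D \<le> 2 * card {x \<in> V. f x \<noteq> 0}"
proof -
  have finH: "finite H" "finite D" using H D finite_V by (meson finite_subset)+
  have h: "card H > 0" using H finH by (simp add: card_gt_0_iff)
  have "card D * (card H / 2) = (\<Sum>t\<in>D. card H / 2)" by simp
  also have "\<dots> \<le> (\<Sum>t\<in>D. real (card {h \<in> H. f (t + h) \<noteq> 0}))" by (intro sum_mono heavy)
  also have "\<dots> = (\<Sum>t\<in>D. \<Sum>h\<in>H. of_bool (f (t + h) \<noteq> 0))"
    using finH by (simp add: Collect_conj_eq)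
  also have "\<dots> = (\<Sum>h\<in>H. \<Sum>t\<in>D. of_bool (f (t + h) \<noteq> 0))" by (rule sum.swap)
  also have "\<dots> \<le> (\<Sum>h\<in>H. real (card {x \<in> V. f x \<noteq> 0}))"
  proof (rule sum_mono)
    fix h assume "h \<in> H"
    then have hV: "h \<in> V" using H by blast
    have "(\<Sum>t\<in>D. of_bool (f (t + h) \<noteq> 0) :: real) = card {t \<in> D. f (t + h) \<noteq> 0}"
      using finH by (simp add: Collect_conj_eq)
    also have "card {t \<in> D. f (t + h) \<noteq> 0} \<le> card {x \<in> V. f x \<noteq> 0}"
    proof (rule card_inj_on_le[where f = "\<lambda>t. h + t"])
      show "inj_on (\<lambda>t. h + t) {t \<in> D. f (t + h) \<noteq> 0}" using hV D by (intro inj_translate) auto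
      show "(\<lambda>t. h + t) ` {t \<in> D. f (t + h) \<noteq> 0} \<subseteq> {x \<in> V. f x \<noteq> 0}"
      proof (intro image_subsetI CollectI conjI)
        fix t assume t: "t \<in> {t \<in> D. f (t + h) \<noteq> 0}"
        then have tV: "t \<in> V" using D by blast
        show "h + t \<in> V" using hV tV by simp
        show "f (h + t) \<noteq> 0" using t comm_add_vec[OF hV tV] by simp
      qed
    qed simp
    finally show "(\<Sum>t\<in>D. of_bool (f (t + h) \<noteq> 0) :: real) \<le> real (card {x \<in> V. f x \<noteq> 0})" by simp
  qed
  also have "\<dots> = card H * card {x \<in> V. f x \<noteq> 0}" by simp
  finally have "card H * real (card D) \<le> card H * real (2 * card {x \<in> V. f x \<noteq> 0})"
    by (simp add: mult_ac)
  then show ?thesis using h by (simp only: mult_le_cancel_left_pos of_nat_0_less_iff of_nat_le_iff)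
qed

text \<open>The coset averages only involve the characters that are trivial on \<open>H\<close>, so an average of size \<open>1/2\<close>
shows that these carry at least \<open>1/2\<close> of the spectral norm.\<close>

lemma abs_coset_avg_le:
  fixes g c :: "bit vec \<Rightarrow> real"
  assumes g: "\<And>x. x \<in> V \<Longrightarrow> g x = (\<Sum>r\<in>V. c r * chi r x)" and H: "subspace H" and t: "t \<in> V"
  shows "\<bar>avg H (\<lambda>h. g (t + h))\<bar> \<le> (\<Sum>r\<in>V. \<bar>c r\<bar> * avg H (chi r))"
proof -
  have HV: "H \<subseteq> V" using H by (simp add: subspace_def)
  have "\<bar>avg H (\<lambda>h. g (t + h))\<bar> \<le> (\<Sum>r\<in>V. \<bar>(c r * avg H (chi r)) * chi r t\<bar>)"
    by (subst avg_expand[where g = g and c = c, OF g HV t]) (auto intro: sum_abs)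
  also have "\<dots> = (\<Sum>r\<in>V. \<bar>c r\<bar> * avg H (chi r))"
  proof (intro sum.cong refl)
    fix r assume "r \<in> V"
    then have "avg H (chi r) \<ge> 0" using avg_subspace_chi[OF H] by force
    then show "\<bar>(c r * avg H (chi r)) * chi r t\<bar> = \<bar>c r\<bar> * avg H (chi r)" by (simp add: abs_mult)
  qed
  finally show ?thesis .
qed

section \<open>Iterating the decomposition\<close>

text \<open>Induction on \<open>j\<close>, twice the spectral norm still available.  In one round the function
\<open>f\<close> becomes \<open>f - Z\<close>, the function \<open>g\<close> loses its coset averages, the norm drops by \<open>1/2\<close>, the distance \<open>\<epsilon>\<close>
between \<open>f\<close> and \<open>g\<close> grows to \<open>2 * \<epsilon> + \<sigma>\<close>, and the bound \<open>\<kappa>\<close> on the kernel doubles.  The factors \<open>2 ^ j\<close> in the hypotheses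
pay for this growth in advance, which makes the hypotheses for \<open>j\<close> follow from those for \<open>Suc j\<close> while \<open>M\<close>, \<open>B\<close>, \<open>E\<close>, \<open>\<theta>\<close>
stay the same.  When the norm is exhausted, \<open>g = 0\<close> and \<open>f\<close> is an integer of absolute value less than \<open>1\<close>.\<close>

lemma signed_sum_of_near_integer:
  fixes M \<theta> B E :: real
  defines "\<sigma> \<equiv> 8 * M\<^sup>2 * sqrt \<theta>" and "P \<equiv> 128 * M ^ 4 * 2 powr (4 * M ^ 4 / \<theta>\<^sup>2)"
  assumes M: "M \<ge> 1" and B: "B > 0" and \<theta>: "0 < \<theta>" "\<theta> \<le> 1 / (2048 * M ^ 4)"
    and E: "E \<le> 1 / 8" "(E + 8 * \<theta> * M) * (4 * B) \<le> 1 / (32 * M\<^sup>2)"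
  shows "\<And>f g c K \<epsilon> \<kappa>. (\<And>x. x \<in> V \<Longrightarrow> f x \<in> \<int>) \<Longrightarrow>
    (\<And>x. x \<in> V \<Longrightarrow> g x = (\<Sum>r\<in>V. c r * chi r x)) \<Longrightarrow> (\<Sum>r\<in>V. \<bar>c r\<bar>) \<le> M \<Longrightarrow> (\<Sum>r\<in>V. \<bar>c r\<bar>) \<le> j / 2 \<Longrightarrow>
    (\<And>x. x \<in> V \<Longrightarrow> g x = (\<Sum>y\<in>V. K y * f (x + y))) \<Longrightarrow> (\<Sum>y\<in>V. \<bar>K y\<bar>) \<le> \<kappa> \<Longrightarrow>
    \<kappa> * 2 ^ j * (M + 1) \<le> B \<Longrightarrow>
    (\<And>x. x \<in> V \<Longrightarrow> \<bar>f x - g x\<bar> \<le> \<epsilon>) \<Longrightarrow> 0 \<le> \<epsilon> \<Longrightarrow> (\<epsilon> + \<sigma>) * 2 ^ j \<le> E \<Longrightarrow>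
    signed_sum (j * (4 * (M + 1) * P)) f"
proof (induction j)
  case 0
  have \<sigma>0: "\<sigma> \<ge> 0" using \<theta> by (simp add: \<sigma>_def)
  have "f x = 0" if x: "x \<in> V" for x
  proof -
    have "wiener 0 g" unfolding wiener_def using "0.prems"(2,4) by (intro exI[of _ c]) simp
    then have "g x = 0" using wiener_abs_le[of 0 g x] x by simp
    then have "\<bar>f x\<bar> < 1" using "0.prems"(8)[OF x] "0.prems"(10) \<sigma>0 E(1) by simp
    then show "f x = 0" using int_cases_abs[OF "0.prems"(1)[OF x]] by linarith
  qed
  then show ?case by (intro signed_sum_zero) auto
next
  case (Suc j)
  note f = Suc.prems(1) and g = Suc.prems(2) and cM = Suc.prems(3) and cj = Suc.prems(4)
    and K = Suc.prems(5) and K\<kappa> = Suc.prems(6) and \<kappa>B = Suc.prems(7) and near = Suc.prems(8)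
    and \<epsilon>0 = Suc.prems(9) and \<epsilon>E = Suc.prems(10)
  have M0: "M > 0" using M by simp
  have \<sigma>0: "\<sigma> \<ge> 0" using \<theta> by (simp add: \<sigma>_def)
  have P0: "P \<ge> 0" using M0 by (simp add: P_def)
  have step0: "0 \<le> 4 * (M + 1) * P" using M0 P0 by simp
  define A where "A = {x \<in> V. f x \<noteq> 0}"
  show ?case
  proof (cases "A = {}")
    case True
    then show ?thesis using step0 M0 P0 by (intro signed_sum_zero) (auto simp: A_def)
  next
    case False
    have \<epsilon>le: "\<epsilon> \<le> E"
    proof -
      have "\<epsilon> * 1 \<le> (\<epsilon> + \<sigma>) * 2 ^ Suc j" using \<epsilon>0 \<sigma>0 by (intro mult_mono one_le_power) auto
      then show ?thesis using \<epsilon>E by simp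
    qed
    have small: "(\<epsilon> + 8 * \<theta> * M) * (4 * B) \<le> 1 / (32 * M\<^sup>2)"
    proof -
      have "(\<epsilon> + 8 * \<theta> * M) * (4 * B) \<le> (E + 8 * \<theta> * M) * (4 * B)"
        using \<epsilon>le B by (intro mult_right_mono) auto
      then show ?thesis using E(2) by linarith
    qed
    have g_wiener: "wiener M g" unfolding wiener_def using g cM by blast
    have \<kappa>0: "\<kappa> \<ge> 0" using K\<kappa> by (rule order_trans[rotated]) (auto intro: sum_nonneg)
    have mass: "(\<Sum>x\<in>V. \<bar>g x\<bar>) \<le> B * card A"
    proof -
      have "(\<Sum>x\<in>V. \<bar>f x\<bar>) \<le> (\<Sum>x\<in>V. (M + 1) * of_bool (f x \<noteq> 0))"
      proof (rule sum_mono)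
        fix x assume x: "x \<in> V"
        show "\<bar>f x\<bar> \<le> (M + 1) * of_bool (f x \<noteq> 0)"
          using near[OF x] wiener_abs_le[OF g_wiener x] \<epsilon>le E(1) by (cases "f x = 0") auto
      qed
      also have "\<dots> = (M + 1) * card A"
        by (simp add: sum_distrib_left[symmetric] A_def Collect_conj_eq)
      finally have L1: "(\<Sum>x\<in>V. \<bar>f x\<bar>) \<le> (M + 1) * card A" .
      have "(\<Sum>x\<in>V. \<bar>g x\<bar>) \<le> \<kappa> * ((M + 1) * card A)"
        using kernel_L1_bound[OF K K\<kappa>] mult_left_mono[OF L1 \<kappa>0] by linarith
      also have "\<dots> \<le> (\<kappa> * 2 ^ Suc j * (M + 1)) * card A"
      proof -
        have "\<kappa> * 1 \<le> \<kappa> * 2 ^ Suc j" using \<kappa>0 by (intro mult_left_mono) (auto simp del: power_Suc)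
        then have "\<kappa> * ((M + 1) * card A) \<le> (\<kappa> * 2 ^ Suc j) * ((M + 1) * card A)"
          using M0 by (intro mult_right_mono) auto
        then show ?thesis by (simp only: mult.assoc)
      qed
      also have "\<dots> \<le> B * card A" using \<kappa>B by (intro mult_right_mono) auto
      finally show ?thesis .
    qed
    have \<epsilon>8: "\<epsilon> \<le> 1 / 8" using \<epsilon>le E by simp
    obtain H where H: "subspace H" and size: "card A \<le> P * card H"
      and nearH: "\<And>t. t \<in> V \<Longrightarrow> \<exists>z\<in>\<int>. \<bar>avg H (\<lambda>h. g (t + h)) - z\<bar> \<le> \<epsilon> + \<sigma>"
      and heavy: "\<And>t. t \<in> V \<Longrightarrow> \<bar>avg H (\<lambda>h. g (t + h))\<bar> \<ge> 1 / 2 \<Longrightarrow> card H / 2 \<le> card {h \<in> H. f (t + h) \<noteq> 0}"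
      and large: "\<exists>t\<in>V. \<bar>avg H (\<lambda>h. g (t + h))\<bar> \<ge> 1 / 2"
      by (rule exists_concentrating_subspace[OF f False[unfolded A_def] g cM near \<epsilon>0 \<epsilon>8
            mass[unfolded A_def] M B \<theta> small]) (auto simp: \<sigma>_def P_def A_def)
    have HV: "H \<subseteq> V" "H \<noteq> {}" using H by (auto simp: subspace_def)
    have finH: "finite H" using HV(1) finite_V by (rule finite_subset)
    have h: "card H > 0" using HV finH by (simp add: card_gt_0_iff)
    define m where "m t = avg H (\<lambda>h. g (t + h))" for t
    define Z :: "bit vec \<Rightarrow> real" where "Z t = of_int (round (m t))" for t
    have m_inv: "m (k + x) = m x" if "k \<in> H" "x \<in> V" for k x
      unfolding m_def by (rule avg_translate_invariant[OF H that])
    have Z_near: "\<bar>m t - Z t\<bar> \<le> \<epsilon> + \<sigma>" if t: "t \<in> V" for t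
    proof -
      obtain i where "\<bar>m t - of_int i\<bar> \<le> \<epsilon> + \<sigma>" using nearH[OF t] unfolding m_def by (blast elim: Ints_cases)
      then show ?thesis using round_diff_minimal[of "m t" i] unfolding Z_def by linarith
    qed
    have Z_round: "\<bar>Z t - m t\<bar> \<le> 1 / 2" for t
      unfolding Z_def using of_int_round_abs_le[of "m t"] by simp
    have Z_int: "Z t \<in> \<int>" for t by (simp add: Z_def)
    have Zsum: "signed_sum (4 * (M + 1) * P) Z"
    proof -
      define D where "D = {x \<in> V. Z x \<noteq> 0}"
      have "card D \<le> 2 * card A"
        unfolding A_def
      proof (rule heavy_support[OF HV])
        fix t assume "t \<in> D"
        then have t: "t \<in> V" "\<bar>Z t\<bar> \<ge> 1" using int_cases_abs[OF Z_int] by (auto simp: D_def)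
        then have "\<bar>m t\<bar> \<ge> 1 / 2" using Z_round[of t] by linarith
        then show "card H / 2 \<le> card {h \<in> H. f (t + h) \<noteq> 0}" using heavy[OF t(1)] by (simp add: m_def)
      qed (auto simp: D_def)
      then have "real (card D) \<le> 2 * (P * card H)" using size by linarith
      then have D: "card D / card H \<le> 2 * P" using h by (simp add: field_simps)
      have "signed_sum (2 * (M + 1) * card D / card H) Z"
        unfolding D_def
      proof (rule signed_sum_invariant[OF H Z_int])
        fix x assume x: "x \<in> V"
        have "\<bar>m x\<bar> \<le> M"
          unfolding m_def using finH HV x M0 by (intro abs_avg_le wiener_abs_le[OF g_wiener]) auto
        then show "\<bar>Z x\<bar> \<le> M + 1" using Z_round[of x] by linarith
        show "Z (k + x) = Z x" if "k \<in> H" for k using m_inv[OF that x] by (simp add: Z_def)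
      qed
      moreover have "2 * (M + 1) * card D / card H \<le> 4 * (M + 1) * P"
        using mult_left_mono[OF D, of "2 * (M + 1)"] M0 by (simp add: mult_ac)
      ultimately show ?thesis by (rule signed_sum_mono)
    qed
    define \<omega> where "\<omega> r = avg H (chi r)" for r
    have \<omega>: "\<omega> r = 0 \<or> \<omega> r = 1" if "r \<in> V" for r unfolding \<omega>_def by (rule avg_subspace_chi[OF H that])
    define f' where "f' x = f x - Z x" for x
    define g' where "g' x = g x - m x" for x
    define c' where "c' r = c r * (1 - \<omega> r)" for r
    define K' where "K' y = K y - avg H (\<lambda>h. K (h + y))" for y
    have g'c': "g' x = (\<Sum>r\<in>V. c' r * chi r x)" if x: "x \<in> V" for x
    proof -
      have "m x = (\<Sum>r\<in>V. c r * \<omega> r * chi r x)"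
        unfolding m_def \<omega>_def by (rule avg_expand[where g = g and c = c, OF g HV(1) x])
      then show ?thesis by (simp add: g'_def c'_def g[OF x] sum_subtractf[symmetric] algebra_simps)
    qed
    have c'sum: "(\<Sum>r\<in>V. \<bar>c' r\<bar>) = (\<Sum>r\<in>V. \<bar>c r\<bar>) - (\<Sum>r\<in>V. \<bar>c r\<bar> * \<omega> r)"
      unfolding sum_subtractf[symmetric]
    proof (intro sum.cong refl)
      fix r assume "r \<in> V"
      then show "\<bar>c' r\<bar> = \<bar>c r\<bar> - \<bar>c r\<bar> * \<omega> r" using \<omega>[of r] by (auto simp: c'_def)
    qed
    have gain: "1 / 2 \<le> (\<Sum>r\<in>V. \<bar>c r\<bar> * \<omega> r)"
    proof -
      obtain t where "t \<in> V" "\<bar>m t\<bar> \<ge> 1 / 2" using large unfolding m_def by blast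
      then show ?thesis using abs_coset_avg_le[OF g H, of t] unfolding m_def \<omega>_def by linarith
    qed
    have "signed_sum (j * (4 * (M + 1) * P)) f'"
    proof (rule Suc.IH)
      show "(\<Sum>r\<in>V. \<bar>c' r\<bar>) \<le> M" "(\<Sum>r\<in>V. \<bar>c' r\<bar>) \<le> j / 2"
        using c'sum gain cM cj by (auto simp: field_simps)
      show "(\<Sum>y\<in>V. \<bar>K' y\<bar>) \<le> 2 * \<kappa>"
        using split_kernel(1)[OF H, of K] K\<kappa> unfolding K'_def by linarith
      show "2 * \<kappa> * 2 ^ j * (M + 1) \<le> B" using \<kappa>B by (simp add: mult_ac)
      show "0 \<le> 2 * \<epsilon> + \<sigma>" using \<epsilon>0 \<sigma>0 by simp
      show "(2 * \<epsilon> + \<sigma> + \<sigma>) * 2 ^ j \<le> E" using \<epsilon>E by (simp add: algebra_simps)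
      fix x assume x: "x \<in> V"
      show "f' x \<in> \<int>" using f[OF x] Z_int by (simp add: f'_def)
      show "g' x = (\<Sum>r\<in>V. c' r * chi r x)" by (rule g'c'[OF x])
      show "\<bar>f' x - g' x\<bar> \<le> 2 * \<epsilon> + \<sigma>"
        using near[OF x] Z_near[OF x] unfolding f'_def g'_def by linarith
      define T where "T F x = (\<Sum>y\<in>V. K y * F (x + y))" for F :: "bit vec \<Rightarrow> real" and x
      \<comment> \<open>The kernel of the next round kills \<open>Z\<close>, because convolution with \<open>K\<close> preserves \<open>H\<close>-invariance.\<close>
      have TZ: "T Z (x + k) = T Z x" if k: "k \<in> H" for k
        unfolding T_def
      proof (intro sum.cong refl)
        fix y assume y: "y \<in> V"
        have kV: "k \<in> V" using k HV by blast
        have "(x + k) + y = k + (x + y)" using kV x y add_left_comm[of x k y] by simp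
        then show "K y * Z ((x + k) + y) = K y * Z (x + y)" using m_inv[OF k, of "x + y"] x y by (simp add: Z_def)
      qed
      have Tf': "T f' z = g z - T Z z" if "z \<in> V" for z
        unfolding T_def f'_def K[OF that] by (simp add: right_diff_distrib sum_subtractf)
      have "(\<Sum>y\<in>V. K' y * f' (x + y)) = T f' x - avg H (\<lambda>k. T f' (x + k))"
        unfolding K'_def T_def by (rule split_kernel(2)[OF H x])
      also have "avg H (\<lambda>k. T f' (x + k)) = avg H (\<lambda>k. g (x + k) - T Z x)"
        unfolding avg_def using HV x by (intro arg_cong2[where f = "(/)"] sum.cong refl) (auto simp: Tf' TZ subset_iff)
      also have "\<dots> = m x - T Z x"
        using h unfolding m_def avg_def by (simp add: sum_subtractf diff_divide_distrib)
      finally show "g' x = (\<Sum>y\<in>V. K' y * f' (x + y))" using Tf'[OF x] by (simp add: g'_def)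
    qed
    from signed_sum_add[OF this Zsum]
    have "signed_sum (j * (4 * (M + 1) * P) + 4 * (M + 1) * P) f"
      by (rule signed_sum_cong) (simp add: f'_def)
    then show ?thesis by (rule signed_sum_mono) (simp add: algebra_simps)
  qed
qed

section \<open>The number of subgroups\<close>

lemma subspace_imp_subgroup:
  assumes H: "subspace H" shows "subgroup H (F2_group n)"
proof -
  interpret comm_group "F2_group n" by (rule comm_group_vec)
  show ?thesis
  proof (rule subgroupI)
    show "H \<subseteq> carrier (F2_group n)" "H \<noteq> {}" using H by (auto simp: subspace_def monoid_vec_simps)
    fix a assume a: "a \<in> H"
    then have "a \<in> V" using H by (auto simp: subspace_def)
    then have "inv\<^bsub>F2_group n\<^esub> a = a"
      by (intro inv_equality) (auto simp: monoid_vec_simps)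
    then show "inv\<^bsub>F2_group n\<^esub> a \<in> H" using a by simp
  next
    fix a b assume "a \<in> H" "b \<in> H"
    then show "a \<otimes>\<^bsub>F2_group n\<^esub> b \<in> H" using H by (simp add: subspace_def monoid_vec_simps)
  qed
qed

lemma sum_of_signed_subgroups:
  assumes F: "signed_sum B F" and B: "B \<le> B'"
  shows "\<exists>(L::nat) (H :: nat \<Rightarrow> bit vec set) (s :: nat \<Rightarrow> real). real L \<le> B' \<and>
    (\<forall>j\<in>{1..L}. subgroup (H j) (F2_group n) \<and> s j \<in> {1, -1}) \<and>
    (\<forall>x\<in>carrier (F2_group n). F x = (\<Sum>j=1..L. s j * indicator (H j) x))"
proof -
  from F obtain ps where ps: "real (length ps) \<le> B"
    "\<And>p. p \<in> set ps \<Longrightarrow> fst p \<in> {1, -1} \<and> subspace (snd p)"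
    "\<And>x. x \<in> V \<Longrightarrow> F x = (\<Sum>p\<leftarrow>ps. fst p * indicator (snd p) x)"
    unfolding signed_sum_def by blast
  define H where "H j = snd (ps ! (j - 1))" for j
  define s where "s j = fst (ps ! (j - 1))" for j
  have "subgroup (H j) (F2_group n) \<and> s j \<in> {1, -1}" if "j \<in> {1..length ps}" for j
  proof -
    have "ps ! (j - 1) \<in> set ps" using that by (intro nth_mem) auto
    then show ?thesis using ps(2) subspace_imp_subgroup unfolding H_def s_def by blast
  qed
  moreover have "F x = (\<Sum>j=1..length ps. s j * indicator (H j) x)" if "x \<in> carrier (F2_group n)" for x
  proof -
    have "F x = (\<Sum>i<length ps. fst (ps ! i) * indicator (snd (ps ! i)) x)"
      using that by (simp add: ps(3) monoid_vec_simps sum_list_sum_nth atLeast0LessThan)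
    also have "\<dots> = (\<Sum>j=1..length ps. s j * indicator (H j) x)"
      unfolding H_def s_def using sum.atLeast1_atMost_eq[of "\<lambda>j. fst (ps ! (j - 1)) * indicator (snd (ps ! (j - 1))) x" "length ps"]
      by simp
    finally show ?thesis .
  qed
  moreover have "real (length ps) \<le> B'" using ps(1) B by linarith
  ultimately show ?thesis by blast
qed

end

text \<open>The number of pinned characters is at most \<open>X\<close>, and the other factors are negligible.  Everything is compared
with powers of \<open>2\<close> through \<open>M \<le> 2 powr M\<close>, whereupon \<open>X \<le> 2 powr (98 * M)\<close>.\<close>

lemma tower_bound:
  fixes M X :: real
  assumes M: "M \<ge> 1" and j: "real j \<le> 2 * M + 1" and X: "X = 2 ^ 50 * M ^ 24 * 2 ^ (8 * j)"
  shows "real j * (4 * (M + 1) * (128 * M ^ 4 * 2 powr X)) \<le> 2 powr (2 powr (99 * M ^ 4))"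
proof -
  have M_powr: "M \<le> 2 powr M"
  proof -
    have "ln (exp 1) \<le> ln (2 ^ 2 :: real)" using exp_le by (subst ln_le_cancel_iff) auto
    then have ln2: "1 / 2 \<le> ln (2 :: real)" by (subst (asm) ln_realpow) auto
    have "ln M \<le> ln 2 + M / 2 - 1"
      using ln_le_minus_one[of "M / 2"] M by (simp add: ln_div)
    also have "\<dots> \<le> M * ln 2"
      using ln2 mult_right_mono[of 1 M "ln 2 - 1 / 2"] M by (simp add: algebra_simps)
    finally have "exp (ln M) \<le> exp (M * ln 2)" by simp
    then show ?thesis using M by (simp add: powr_def)
  qed
  have pow: "M ^ k \<le> 2 powr (k * M)" for k
  proof -
    have "M ^ k \<le> (2 powr M) ^ k" using M_powr M by (intro power_mono) auto
    also have "\<dots> = 2 powr (k * M)" by (simp add: powr_powr[symmetric] powr_realpow[symmetric] mult.commute)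
    finally show ?thesis .
  qed
  have "X = 2 powr 50 * M ^ 24 * 2 powr (8 * j)"
    unfolding X using powr_realpow[of 2 50] powr_realpow[of 2 "8 * j"] by simp
  also have "\<dots> \<le> 2 powr 50 * 2 powr (24 * M) * 2 powr (8 * (2 * M + 1))"
    using pow[of 24] j M by (intro mult_mono powr_mono) auto
  also have "\<dots> = 2 powr (58 + 40 * M)"
    by (simp only: powr_add[symmetric]) (simp add: algebra_simps)
  also have "\<dots> \<le> 2 powr (98 * M)" using M by (intro powr_mono) auto
  finally have X98: "X \<le> 2 powr (98 * M)" .
  have "real j * (4 * (M + 1) * (128 * M ^ 4 * 2 powr X)) \<le> (3 * M) * (4 * (2 * M) * (128 * M ^ 4 * 2 powr X))"
    using j M by (intro mult_mono) auto
  also have "\<dots> = 3072 * M ^ 6 * 2 powr X" by (simp add: eval_nat_numeral)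
  also have "\<dots> \<le> 2 powr 12 * 2 powr (6 * M) * 2 powr X"
    using pow[of 6] powr_realpow[of 2 12] M by (intro mult_mono) auto
  also have "\<dots> = 2 powr (12 + 6 * M + X)" by (simp add: powr_add)
  also have "\<dots> \<le> 2 powr (2 powr (99 * M ^ 4))"
  proof (intro powr_mono)
    have "18 * M \<le> 2 powr (98 * M)"
    proof -
      have "18 * M \<le> 2 powr 5 * 2 powr M" using M_powr powr_realpow[of 2 5] M by (intro mult_mono) auto
      also have "\<dots> = 2 powr (5 + M)" by (simp add: powr_add)
      also have "\<dots> \<le> 2 powr (98 * M)" using M by (intro powr_mono) auto
      finally show ?thesis .
    qed
    then have "12 + 6 * M + X \<le> 2 * 2 powr (98 * M)" using X98 M by linarith
    also have "\<dots> = 2 powr (1 + 98 * M)" by (simp add: powr_add)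
    also have "\<dots> \<le> 2 powr (99 * M ^ 4)"
    proof (intro powr_mono)
      have "M ^ 1 \<le> M ^ 4" using M by (intro power_increasing) auto
      then show "1 + 98 * M \<le> 99 * M ^ 4" using M by simp
    qed auto
    finally show "12 + 6 * M + X \<le> 2 powr (99 * M ^ 4)" .
  qed auto
  finally show ?thesis .
qed

context hypercube
begin

text \<open>The first round starts from \<open>g = f\<close>, with the unit mass at \<open>0\<close> as kernel and no error, and \<open>j\<close> rounds are
enough as \<open>M \<le> j / 2\<close>.  The constant \<open>B\<close> is the least one allowed.  The two remaining constraints are that \<open>\<theta>\<close> is small in terms of \<open>B\<close>, and
that the error accumulated in \<open>j\<close> rounds, at most \<open>\<sigma> * 2 ^ j = E\<close>, is small in terms of \<open>B\<close>.  The second is the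
more restrictive; it dictates the choice \<open>sqrt \<theta> = 1 / q\<close>.\<close>

lemma signed_sum_of_boolean:
  assumes f: "\<And>x. x \<in> V \<Longrightarrow> f x \<in> {0, 1}" and fM: "spectral_norm n f \<le> M" and M: "M \<ge> 1"
  shows "\<exists>B. signed_sum B f \<and> B \<le> 2 powr (2 powr (99 * M ^ 4))"
proof -
  define j where "j = nat \<lceil>2 * M\<rceil>"
  have j: "2 * M \<le> real j" "real j \<le> 2 * M + 1" using M by (auto simp: j_def)
  define p :: real where "p = 2 ^ j"
  have p: "p \<ge> 1" by (simp add: p_def)
  have M0: "M > 0" using M by simp
  define q where "q = 2 ^ 12 * M ^ 5 * p\<^sup>2"
  define \<theta> where "\<theta> = (1 / q)\<^sup>2"
  define B where "B = p * (M + 1)"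
  define E where "E = 1 / (2 ^ 9 * M ^ 3 * p)"
  have q: "q > 0" using M0 p by (simp add: q_def)
  have sqrt\<theta>: "sqrt \<theta> = 1 / q" using q by (simp add: \<theta>_def)
  have \<theta>0: "\<theta> > 0" using q by (simp add: \<theta>_def)
  have \<theta>_eq: "\<theta> = 1 / (2 ^ 24 * M ^ 10 * p ^ 4)"
    unfolding \<theta>_def q_def by (simp add: power_mult_distrib power_divide power_mult[symmetric])
  have ge1: "M ^ k \<ge> 1" "p ^ k \<ge> 1" for k using M p by auto
  have \<theta>_le: "\<theta> \<le> 1 / (2048 * M ^ 4)"
  proof -
    have "2048 * M ^ 4 * 1 \<le> 2 ^ 24 * M ^ 10 * p ^ 4"
      using M ge1 by (intro mult_mono power_increasing) auto
    then show ?thesis unfolding \<theta>_eq using M0 p by (intro divide_left_mono) (auto intro!: mult_pos_pos)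
  qed
  have E8: "E \<le> 1 / 8"
  proof -
    have "8 * 1 * 1 \<le> 2 ^ 9 * M ^ 3 * p" using ge1[of 3] p M0 by (intro mult_mono) auto
    then show ?thesis unfolding E_def by (intro divide_left_mono) auto
  qed
  have small: "(E + 8 * \<theta> * M) * (4 * B) \<le> 1 / (32 * M\<^sup>2)"
  proof -
    have "8 * \<theta> * M \<le> E"
    proof -
      have "8 * (2 ^ 9 * M ^ 3 * p) * M = 2 ^ 12 * M ^ 4 * p ^ 1" by (simp add: eval_nat_numeral)
      also have "\<dots> \<le> 2 ^ 24 * M ^ 10 * p ^ 4" using M p by (intro mult_mono power_increasing) auto
      finally have "8 * (2 ^ 9 * M ^ 3 * p) * M \<le> 2 ^ 24 * M ^ 10 * p ^ 4" .
      then show ?thesis unfolding \<theta>_eq E_def using M0 p by (simp add: divide_simps mult_ac)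
    qed
    then have "E + 8 * \<theta> * M \<le> 2 * E" by linarith
    moreover have "4 * B \<le> 4 * (p * (2 * M))" unfolding B_def using M p by simp
    moreover have "0 \<le> 2 * E" using M0 p by (simp add: E_def)
    moreover have "0 \<le> 4 * B" using M0 p by (simp add: B_def)
    ultimately have "(E + 8 * \<theta> * M) * (4 * B) \<le> (2 * E) * (4 * (p * (2 * M)))"
      by (rule mult_mono)
    also have "\<dots> = 1 / (32 * M\<^sup>2)"
      unfolding E_def using M0 p by (simp add: field_simps power2_eq_square power3_eq_cube)
    finally show ?thesis .
  qed
  have \<sigma>: "8 * M\<^sup>2 * sqrt \<theta> * 2 ^ j = E"
    unfolding sqrt\<theta> q_def E_def p_def[symmetric] using M0 p
    by (simp add: field_simps eval_nat_numeral)
  define K :: "bit vec \<Rightarrow> real" where "K y = of_bool (y = 0\<^sub>v n)" for y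
  have K_sum: "(\<Sum>y\<in>V. K y * F y) = F (0\<^sub>v n)" for F :: "bit vec \<Rightarrow> real"
  proof -
    have "(\<Sum>y\<in>V. K y * F y) = (\<Sum>y\<in>V. if y = 0\<^sub>v n then F y else 0)"
      by (intro sum.cong) (auto simp: K_def)
    then show ?thesis by simp
  qed
  have c: "(\<Sum>r\<in>V. \<bar>fourier_transform n f r\<bar>) \<le> M"
    using fM by (simp add: spectral_norm_def monoid_vec_simps)
  have "signed_sum (real j * (4 * (M + 1) * (128 * M ^ 4 * 2 powr (4 * M ^ 4 / \<theta>\<^sup>2)))) f"
  proof (rule signed_sum_of_near_integer[where g = f and c = "fourier_transform n f" and K = K
        and \<kappa> = 1 and \<epsilon> = 0 and B = B and E = E and \<theta> = \<theta>])
    show "B > 0" using M0 p by (simp add: B_def)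
    show "(\<Sum>y\<in>V. \<bar>K y\<bar>) \<le> 1" using K_sum[of "\<lambda>_. 1"] by (simp add: K_def)
    show "1 * 2 ^ j * (M + 1) \<le> B" by (simp add: B_def p_def)
    show "(\<Sum>r\<in>V. \<bar>fourier_transform n f r\<bar>) \<le> real j / 2" using c j by linarith
    show "(0 + 8 * M\<^sup>2 * sqrt \<theta>) * 2 ^ j \<le> E" using \<sigma> by simp
    fix x assume x: "x \<in> V"
    show "f x \<in> \<int>" using f[OF x] by auto
    show "f x = (\<Sum>y\<in>V. K y * f (x + y))" using K_sum[of "\<lambda>y. f (x + y)"] x by simp
    show "f x = (\<Sum>r\<in>V. fourier_transform n f r * chi r x)" by (rule fourier_inversion[OF x])
  qed (use M \<theta>0 \<theta>_le E8 small c in auto)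
  moreover have "4 * M ^ 4 / \<theta>\<^sup>2 = 2 ^ 50 * M ^ 24 * 2 ^ (8 * j)"
  proof -
    have "4 * M ^ 4 / \<theta>\<^sup>2 = 4 * M ^ 4 * (2 ^ 24 * M ^ 10 * p ^ 4)\<^sup>2"
      unfolding \<theta>_eq by (simp add: power_divide)
    also have "\<dots> = (4 * (2 ^ 24)\<^sup>2) * (M ^ 4 * (M ^ 10)\<^sup>2) * (p ^ 4)\<^sup>2"
      by (simp only: power_mult_distrib mult_ac)
    also have "\<dots> = 2 ^ 50 * M ^ 24 * p ^ 8"
      by (simp add: power_mult[symmetric] power_add[symmetric])
    also have "p ^ 8 = 2 ^ (8 * j)" by (simp add: p_def power_mult[symmetric] mult.commute)
    finally show ?thesis .
  qed
  ultimately show ?thesis using tower_bound[OF M j(2)] by blast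
qed

end

theorem theorem1p3:
  shows "\<exists>C::real. C > 0 \<and>
    (\<forall>(n::nat) (M::real) (f :: bit vec \<Rightarrow> real).
      n > 0 \<longrightarrow> M > 0 \<longrightarrow>
      (\<forall>x\<in>carrier (F2_group n). f x \<in> {0, 1}) \<longrightarrow>
      spectral_norm n f \<le> M \<longrightarrow>
      (\<exists>(L::nat) (H :: nat \<Rightarrow> bit vec set) (s :: nat \<Rightarrow> real).
        real L \<le> 2 powr (2 powr (C * M ^ 4)) \<and>
        (\<forall>j\<in>{1..L}. subgroup (H j) (F2_group n) \<and> s j \<in> {1, -1}) \<and>
        (\<forall>x\<in>carrier (F2_group n). f x = (\<Sum>j=1..L. s j * indicator (H j) x))))"
proof (rule exI[of _ 99], intro conjI allI impI)
  fix n :: nat and M :: real and f :: "bit vec \<Rightarrow> real"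
  assume f01: "\<forall>x\<in>carrier (F2_group n). f x \<in> {0, 1}" and fM: "spectral_norm n f \<le> M"
  interpret hypercube n .
  have f: "f x \<in> {0, 1}" if "x \<in> V" for x using f01 that by (auto simp: monoid_vec_simps)
  have "\<exists>B. signed_sum B f \<and> B \<le> 2 powr (2 powr (99 * M ^ 4))"
  proof (cases "M \<ge> 1")
    case True
    show ?thesis by (rule signed_sum_of_boolean[OF f fM True])
  next
    case False
    have "wiener M f"
      unfolding wiener_def using fM fourier_inversion
      by (intro exI[of _ "fourier_transform n f"]) (auto simp: spectral_norm_def monoid_vec_simps)
    then have "f x = 0" if "x \<in> V" for x
      using wiener_abs_le[of M f x] f[OF that] that False by auto
    then show ?thesis by (intro exI[of _ 0] conjI signed_sum_zero) auto
  qed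
  then show "\<exists>(L::nat) (H :: nat \<Rightarrow> bit vec set) (s :: nat \<Rightarrow> real).
        real L \<le> 2 powr (2 powr (99 * M ^ 4)) \<and>
        (\<forall>j\<in>{1..L}. subgroup (H j) (F2_group n) \<and> s j \<in> {1, -1}) \<and>
        (\<forall>x\<in>carrier (F2_group n). f x = (\<Sum>j=1..L. s j * indicator (H j) x))"
    using sum_of_signed_subgroups by blast
qed simp

end
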